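(* Let $n\ge 2$. Every pluriharmonic measure $\mu\in M(\mathbb{T}^n)$ satisfies $\dim_{\mathcal H}\mu\ge n-1$. Moreover, this estimate is sharp for every $n\ge 2$: the measure \[ \mu=\delta_1(\xi_1)\otimes m(\xi_2)\otimes\cdots\otimes m(\xi_n) \] on $\mathbb{T}^n$, where $\delta_1$ is the Dirac measure at $1\in\mathbb{T}$ and $m$ is the normalized Lebesgue measure on $\mathbb{T}$, is pluriharmonic and $\dim_{\mathcal H}\mu=n-1$.
   Context: $\mathbb{T}=\{\lambda\in\mathbb{C}:|\lambda|=1\}$, $\mathbb{T}^n\subset\mathbb{C}^n$ carries the Euclidean metric, and $M(\mathbb{T}^n)$ is the space of complex Borel measures on $\mathbb{T}^n$. For $\mu\in M(\mathbb{T}^n)$ and $(k_1,\dots,k_n)\in\mathbb{Z}^n$, $\hat\mu(k_1,\dots,k_n)=\int_{\mathbb{T}^n}\overline{\xi}_1^{\,k_1}\cdots\overline{\xi}_n^{\,k_n}\,d\mu(\xi)$. Put $\mathbb{Z}_+=\{0,1,2,\dots\}$ and $\mathbb{Z}_-=\{0,-1,-2,\dots\}$. A measure $\mu\in M(\mathbb{T}^n)$ is called pluriharmonic if $\hat\mu(k_1,\dots,k_n)=0$ for all $(k_1,\dots,k_n)\in\mathbb{Z}^n\setminus(\mathbb{Z}_-^n\cup\mathbb{Z}_+^n)$. The Hausdorff dimension of $\mu\in M(\mathbb{T}^n)$ is $\dim_{\mathcal H}\mu=\inf\{\dim_{\mathcal H}E: E\subset\mathbb{T}^n\text{ Borel},\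 |\mu|(E)>0\}$, where $|\mu|$ is the total variation of $\mu$ (so $|\mu|=\mu$ for positive $\mu$), $\dim_{\mathcal H}E$ is the Hausdorff dimension of the set $E$, and $\inf\emptyset=+\infty$. *)

theory Defs
  imports "HOL-Probability.Probability"
begin

section \<open>Complex measures\<close>

(* A (real- or complex-valued) measure on the measurable space M is a countably additive set
   function; only its values on "sets M" matter.  Absolute convergence is automatic, since
   permuting the sets A i does not change their union. *)
definition countably_additive_on ::
    "'a measure \<Rightarrow> ('a set \<Rightarrow> 'b::real_normed_vector) \<Rightarrow> bool" where
  "countably_additive_on M \<mu> \<longleftrightarrow>
     (\<forall>A :: nat \<Rightarrow> 'a set. range A \<subseteq> sets M \<longrightarrow> disjoint_family A \<longrightarrow>
        (\<lambda>i. \<mu> (A i)) sums \<mu> (\<Union>i. A i))"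

abbreviation complex_measure :: "'a measure \<Rightarrow> ('a set \<Rightarrow> complex) \<Rightarrow> bool" where
  "complex_measure M \<mu> \<equiv> countably_additive_on M \<mu>"

definition total_variation ::
    "'a measure \<Rightarrow> ('a set \<Rightarrow> 'b::real_normed_vector) \<Rightarrow> 'a set \<Rightarrow> ennreal" where
  "total_variation M \<mu> E =
     (SUP A \<in> {A :: nat \<Rightarrow> 'a set. range A \<subseteq> sets M \<and> disjoint_family A \<and> (\<Union>i. A i) = E}.
        (\<Sum>i. ennreal (norm (\<mu> (A i)))))"

(* Positive part (|\<nu>| + \<nu>) / 2 in the Jordan decomposition of a real measure \<nu>;
   the negative part is the positive part of -\<nu>. *)
definition positive_part :: "'a measure \<Rightarrow> ('a set \<Rightarrow> real) \<Rightarrow> 'a measure" where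
  "positive_part M \<nu> = measure_of (space M) (sets M)
     (\<lambda>E. ennreal ((enn2real (total_variation M \<nu> E) + \<nu> E) / 2))"

definition real_measure_integral ::
    "'a measure \<Rightarrow> ('a set \<Rightarrow> real) \<Rightarrow> ('a \<Rightarrow> complex) \<Rightarrow> complex" where
  "real_measure_integral M \<nu> f =
     (\<integral>x. f x \<partial>positive_part M \<nu>) - (\<integral>x. f x \<partial>positive_part M (\<lambda>E. - \<nu> E))"

definition complex_measure_integral ::
    "'a measure \<Rightarrow> ('a set \<Rightarrow> complex) \<Rightarrow> ('a \<Rightarrow> complex) \<Rightarrow> complex" where
  "complex_measure_integral M \<mu> f =
     real_measure_integral M (\<lambda>E. Re (\<mu> E)) f + \<i> * real_measure_integral M (\<lambda>E. Im (\<mu> E)) f"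


section \<open>Hausdorff dimension\<close>

(* diam(U)^s with the usual conventions for s = 0: a nonempty set has gauge 1 and the empty set
   has gauge 0 (note that "0 powr 0 = 0" in HOL). *)
definition hausdorff_gauge :: "real \<Rightarrow> 'a::metric_space set \<Rightarrow> ennreal" where
  "hausdorff_gauge s U =
     (if U = {} then 0 else if s = 0 then 1 else ennreal (diameter U powr s))"

(* Boundedness is required because "diameter" is meaningless for unbounded sets. *)
definition hausdorff_premeasure :: "real \<Rightarrow> real \<Rightarrow> 'a::metric_space set \<Rightarrow> ennreal" where
  "hausdorff_premeasure s \<delta> E =
     (INF U \<in> {U :: nat \<Rightarrow> 'a set. E \<subseteq> (\<Union>i. U i) \<and> (\<forall>i. bounded (U i) \<and> diameter (U i) \<le> \<delta>)}.
        (\<Sum>i. hausdorff_gauge s (U i)))"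

definition hausdorff_measure :: "real \<Rightarrow> 'a::metric_space set \<Rightarrow> ennreal" where
  "hausdorff_measure s E = (SUP \<delta> \<in> {0<..}. hausdorff_premeasure s \<delta> E)"

definition hausdorff_dim :: "'a::metric_space set \<Rightarrow> ereal" where
  "hausdorff_dim E = (INF s \<in> {s. 0 \<le> s \<and> hausdorff_measure s E = 0}. ereal s)"

(* The infimum is taken in the extended reals, so it is \<infinity> for the zero measure. *)
definition measure_hausdorff_dim ::
    "'a::metric_space measure \<Rightarrow> ('a set \<Rightarrow> complex) \<Rightarrow> ereal" where
  "measure_hausdorff_dim M \<mu> =
     (INF E \<in> {E \<in> sets M. total_variation M \<mu> E > 0}. hausdorff_dim E)"


section \<open>Measures on the torus\<close>

(* The norm on "complex ^ 'n" is the Euclidean one, so the torus carries the Euclidean metric. *)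
definition torus :: "(complex ^ 'n) set" where
  "torus = {\<xi>. \<forall>i. cmod (\<xi> $ i) = 1}"

definition torus_borel :: "(complex ^ 'n) measure" where
  "torus_borel = restrict_space borel torus"

definition fourier_coeff :: "((complex ^ 'n) set \<Rightarrow> complex) \<Rightarrow> int ^ 'n \<Rightarrow> complex" where
  "fourier_coeff \<mu> k =
     complex_measure_integral torus_borel \<mu> (\<lambda>\<xi>. \<Prod>i\<in>UNIV. cnj (\<xi> $ i) powi (k $ i))"

definition pluriharmonic :: "((complex ^ 'n) set \<Rightarrow> complex) \<Rightarrow> bool" where
  "pluriharmonic \<mu> \<longleftrightarrow> complex_measure torus_borel \<mu> \<and>
     (\<forall>k. \<not> (\<forall>i. k $ i \<le> 0) \<and> \<not> (\<forall>i. 0 \<le> k $ i) \<longrightarrow> fourier_coeff \<mu> k = 0)"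

definition circle_borel :: "complex measure" where
  "circle_borel = restrict_space borel {z. cmod z = 1}"

definition circle_lebesgue :: "complex measure" where
  "circle_lebesgue = distr (uniform_measure lborel {0..1}) circle_borel (\<lambda>t. cis (2 * pi * t))"

(* Dirac measure at 1 in the coordinate j, normalized Lebesgue measure in all others.
   The product lives on functions 'n \<Rightarrow> complex and is transported to "complex ^ 'n". *)
definition dirac_lebesgue :: "'n::finite \<Rightarrow> (complex ^ 'n) measure" where
  "dirac_lebesgue j =
     distr (PiM UNIV (\<lambda>i. if i = j then return circle_borel 1 else circle_lebesgue))
       torus_borel vec_lambda"

end

theory Submission
  imports Defs
begin

text \<open>
  Let the circle act diagonally on the torus. If \<open>\<mu>\<close> is pluriharmonic and \<open>\<chi>\<close> is a character, then
  convolving \<open>\<chi> \<cdot> \<mu>\<close> with Haar measure on the diagonal circle keeps only the coefficients of \<open>\<mu>\<close> at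
  frequencies with one prescribed coordinate sum. Only finitely many frequencies with entries of one
  sign have this sum, so the convolution has a trigonometric polynomial as density. Hence
  \<open>\<integral>\<^sub>B \<chi> d\<mu> = 0\<close> for every \<open>\<chi>\<close> and every Haar-null invariant Borel set \<open>B\<close>, that is, \<open>|\<mu>|\<close>
  vanishes on \<open>B\<close>. A set of vanishing \<open>(n-1)\<close>-dimensional Hausdorff measure lies in such a \<open>B\<close>,
  because the saturation of a set of diameter \<open>r\<close> has Haar measure \<open>O(r ^ (n-1))\<close>.
\<close>

section \<open>Hahn and Jordan decompositions\<close>

text \<open>The exponent n-1 is the dimension of the quotient of the torus by the diagonal circle.
  The quotients \<xi>_i / \<xi>_j, for a fixed reference index j, are coordinates on it; being
  Lipschitz on the torus, they send a set of diameter r into a box of side O(r), whose preimage is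
  the tube used for the saturation. Countable covers of total cost e give invariant sets of Haar
  measure O(e), and B is the intersection of these as e tends to 0. Multiplication by a character is
  what turns one scalar identity into the vanishing of all Fourier coefficients of the restriction
  of \<mu> to B; invariance of B is what lets its indicator survive the averaging. Two circumstances
  shape the formal argument. The integral against a complex measure is defined through total
  variations of its real and imaginary parts, so Hahn sets must be constructed before any integral
  can be evaluated. The convolved measure is handled only as a functional on bounded measurable
  functions, so that averaging, weighting and subtracting a density are operations on functionals
  and one uniqueness theorem serves all of them.\<close>

lemma countably_additive_on_empty:
  assumes "countably_additive_on M \<nu>"
  shows "\<nu> {} = 0"
proof -
  have "(\<lambda>i::nat. \<nu> ({}::'a set)) sums \<nu> (\<Union>i::nat. {})"
    using assms unfolding countably_additive_on_def
    by (elim allE[of _ "\<lambda>_. {}"]) (auto simp: disjoint_family_on_def)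
  then have "(\<lambda>i::nat. \<nu> {}) \<longlonglongrightarrow> 0"
    using sums_summable summable_LIMSEQ_zero by blast
  then show ?thesis
    by (simp add: LIMSEQ_const_iff)
qed

lemma countably_additive_on_UN:
  assumes "countably_additive_on M \<nu>" "\<And>i. A i \<in> sets M" "disjoint_family A"
  shows "(\<lambda>i::nat. \<nu> (A i)) sums \<nu> (\<Union>i. A i)"
  using assms unfolding countably_additive_on_def by blast

lemma disjoint_family_binaryset: "A \<inter> B = {} \<Longrightarrow> disjoint_family (binaryset A B)"
  by (auto simp: disjoint_family_on_def binaryset_def)

lemma countably_additive_on_Un:
  assumes "countably_additive_on M \<nu>" "A \<in> sets M" "B \<in> sets M" "A \<inter> B = {}"
  shows "\<nu> (A \<union> B) = \<nu> A + \<nu> B"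
proof -
  have "(\<lambda>i. \<nu> (binaryset A B i)) sums \<nu> (\<Union>i. binaryset A B i)"
    using assms by (intro countably_additive_on_UN disjoint_family_binaryset)
      (auto simp: binaryset_def)
  moreover have "(\<lambda>i. \<nu> (binaryset A B i)) sums (\<nu> A + \<nu> B)"
    using countably_additive_on_empty[OF assms(1)] by (rule binaryset_sums)
  ultimately show ?thesis
    by (metis UN_binaryset_eq sums_unique2)
qed

lemma countably_additive_on_split:
  assumes "countably_additive_on M \<nu>" "A \<in> sets M" "P \<in> sets M"
  shows "\<nu> A = \<nu> (A \<inter> P) + \<nu> (A - P)"
  using countably_additive_on_Un[OF assms(1), of "A \<inter> P" "A - P"] assms
  by (simp add: Int_Diff_Un Diff_Int_distrib2 inf.absorb_iff2 Int_Diff_disjoint)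

lemma countably_additive_on_uminus:
  fixes \<nu> :: "'a set \<Rightarrow> 'b::real_normed_vector"
  shows "countably_additive_on M \<nu> \<Longrightarrow> countably_additive_on M (\<lambda>E. - \<nu> E)"
  unfolding countably_additive_on_def by (auto intro: sums_minus)

text \<open>Greedy exhaustion: each \<open>B n\<close> takes at least half of what is available outside its
  predecessors, with the amount capped at 1 because boundedness of \<open>\<nu>\<close> is not yet known.\<close>

lemma countably_additive_on_exhaustion:
  fixes \<nu> :: "'a set \<Rightarrow> real"
  assumes \<nu>: "countably_additive_on M \<nu>" and "\<C> \<subseteq> sets M" "{} \<in> \<C>"
  obtains B :: "nat \<Rightarrow> 'a set" where "\<And>n. B n \<in> \<C>" "disjoint_family B" "\<And>n. 0 \<le> \<nu> (B n)"
    "\<And>C. C \<in> \<C> \<Longrightarrow> C \<inter> (\<Union>n. B n) = {} \<Longrightarrow> \<nu> C \<le> 0"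
proof -
  have ex: "\<exists>C. C \<in> \<C> \<and> C \<inter> S = {} \<and> 0 \<le> \<nu> C \<and> (\<forall>C'\<in>\<C>. C' \<inter> S = {} \<longrightarrow> min 1 (\<nu> C') \<le> 2 * \<nu> C)" for S
  proof -
    define V where "V = (\<lambda>C. min 1 (\<nu> C)) ` {C \<in> \<C>. C \<inter> S = {}}"
    have V: "0 \<in> V" "bdd_above V"
      using assms countably_additive_on_empty[OF \<nu>]
      by (auto simp: V_def image_iff intro!: bexI[of _ "{}"] bdd_aboveI[of _ 1])
    show ?thesis
    proof (cases "Sup V > 0")
      case True
      then obtain v where "v \<in> V" "v > Sup V / 2"
        using less_cSup_iff[of V "Sup V / 2"] V by auto
      then obtain C where C: "C \<in> \<C>" "C \<inter> S = {}" "min 1 (\<nu> C) > Sup V / 2"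
        unfolding V_def by blast
      have "min 1 (\<nu> C') \<le> 2 * \<nu> C" if "C' \<in> \<C>" "C' \<inter> S = {}" for C'
      proof -
        have "min 1 (\<nu> C') \<le> Sup V"
          using that V by (intro cSup_upper) (auto simp: V_def)
        then show ?thesis using C by linarith
      qed
      then show ?thesis using C True by (intro exI[of _ C]) auto
    next
      case False
      have "min 1 (\<nu> C') \<le> 0" if "C' \<in> \<C>" "C' \<inter> S = {}" for C'
        using cSup_upper[of "min 1 (\<nu> C')" V] that V False by (auto simp: V_def)
      then show ?thesis using assms countably_additive_on_empty[OF \<nu>]
        by (intro exI[of _ "{}"]) auto
    qed
  qed
  obtain g where g_all: "\<forall>S. g S \<in> \<C> \<and> g S \<inter> S = {} \<and> 0 \<le> \<nu> (g S) \<and>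
      (\<forall>C'\<in>\<C>. C' \<inter> S = {} \<longrightarrow> min 1 (\<nu> C') \<le> 2 * \<nu> (g S))"
    by (rule choice[OF allI[OF ex], THEN exE])
  have g: "g S \<in> \<C>" "g S \<inter> S = {}" "0 \<le> \<nu> (g S)" for S
    using g_all[rule_format, of S] by simp_all
  have g_max: "min 1 (\<nu> C') \<le> 2 * \<nu> (g S)" if "C' \<in> \<C>" "C' \<inter> S = {}" for C' S
    using g_all[rule_format, of S] that by simp
  define S where "S = rec_nat {} (\<lambda>_ S. S \<union> g S)"
  define B where "B n = g (S n)" for n
  have S_Suc: "S (Suc n) = S n \<union> B n" for n
    by (simp add: S_def B_def)
  have B_S: "B n \<inter> S n = {}" for n
    unfolding B_def by (rule g(2))
  have S_eq: "S n = (\<Union>k<n. B k)" for n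
    by (induction n) (auto simp: S_Suc lessThan_Suc, simp add: S_def)
  have disj: "disjoint_family B"
  proof -
    have "B m \<inter> B n = {}" if "m < n" for m n
      using B_S[of n] that unfolding S_eq by blast
    then show ?thesis
      unfolding disjoint_family_on_def by (auto simp: neq_iff Int_commute)
  qed
  have B_in: "B n \<in> \<C>" "0 \<le> \<nu> (B n)" for n
    unfolding B_def by (rule g)+
  \<comment> \<open>The total amount taken is a finite real, so the amounts tend to 0, whereas a
    leftover C with \<open>\<nu> C > 0\<close> would keep each of them at or above half of
    \<open>min 1 (\<nu> C)\<close>.\<close>
  have "(\<lambda>n. \<nu> (B n)) sums \<nu> (\<Union>n. B n)"
    using B_in(1) assms disj by (intro countably_additive_on_UN[OF \<nu>]) auto
  then have lim: "(\<lambda>n. 2 * \<nu> (B n)) \<longlonglongrightarrow> 2 * 0"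
    by (intro tendsto_intros summable_LIMSEQ_zero) (rule sums_summable)
  have "\<nu> C \<le> 0" if C: "C \<in> \<C>" "C \<inter> (\<Union>n. B n) = {}" for C
  proof -
    have "min 1 (\<nu> C) \<le> 2 * \<nu> (B n)" for n
    proof -
      have "C \<inter> S n = {}"
        using C(2) unfolding S_eq by blast
      then show ?thesis
        unfolding B_def by (rule g_max[OF C(1)])
    qed
    then have "min 1 (\<nu> C) \<le> 2 * 0"
      by (intro LIMSEQ_le_const[OF lim]) blast
    then show ?thesis by linarith
  qed
  then show ?thesis
    using that[of B] B_in disj by blast
qed

text \<open>Exhaust D by pieces of nonnegative value and discard them: this can only lower the
  value, and what remains contains no set of positive value.\<close>

lemma negative_subset:
  fixes \<nu> :: "'a set \<Rightarrow> real"
  assumes \<nu>: "countably_additive_on M \<nu>" and D: "D \<in> sets M"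
  obtains A where "A \<in> sets M" "A \<subseteq> D" "\<nu> A \<le> \<nu> D" "\<And>C. C \<in> sets M \<Longrightarrow> C \<subseteq> A \<Longrightarrow> \<nu> C \<le> 0"
proof -
  obtain B :: "nat \<Rightarrow> 'a set" where B: "\<And>n. B n \<in> {C \<in> sets M. C \<subseteq> D}" "disjoint_family B"
      "\<And>n. 0 \<le> \<nu> (B n)"
      "\<And>C. C \<in> {C \<in> sets M. C \<subseteq> D} \<Longrightarrow> C \<inter> (\<Union>n. B n) = {} \<Longrightarrow> \<nu> C \<le> 0"
    by (rule countably_additive_on_exhaustion[OF \<nu>, of "{C \<in> sets M. C \<subseteq> D}"]) auto
  have "(\<lambda>n. \<nu> (B n)) sums \<nu> (\<Union>n. B n)"
    using B by (intro countably_additive_on_UN[OF \<nu>]) auto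
  then have "\<nu> (\<Union>n. B n) \<ge> 0"
    by (rule sums_le[OF B(3) sums_zero])
  moreover have "\<nu> D = \<nu> (D \<inter> (\<Union>n. B n)) + \<nu> (D - (\<Union>n. B n))"
    using B(1) D by (intro countably_additive_on_split[OF \<nu>]) auto
  moreover have "D \<inter> (\<Union>n. B n) = (\<Union>n. B n)"
    using B(1) by auto
  ultimately have le: "\<nu> (D - (\<Union>n. B n)) \<le> \<nu> D"
    by simp
  show ?thesis
  proof (rule that[OF _ _ le])
    show "D - (\<Union>n. B n) \<in> sets M"
      using B(1) D by (intro sets.Diff sets.countable_UN) auto
    show "\<nu> C \<le> 0" if "C \<in> sets M" "C \<subseteq> D - (\<Union>n. B n)" for C
      using that by (intro B(4)) auto
  qed auto
qed

definition Hahn_set :: "'a measure \<Rightarrow> ('a set \<Rightarrow> real) \<Rightarrow> 'a set \<Rightarrow> bool" where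
  "Hahn_set M \<nu> P \<longleftrightarrow> P \<in> sets M \<and> (\<forall>A\<in>sets M. 0 \<le> \<nu> (A \<inter> P) \<and> \<nu> (A - P) \<le> 0)"

lemma Hahn_setD:
  assumes "Hahn_set M \<nu> P"
  shows "P \<in> sets M" "A \<in> sets M \<Longrightarrow> 0 \<le> \<nu> (A \<inter> P)" "A \<in> sets M \<Longrightarrow> \<nu> (A - P) \<le> 0"
  using assms by (auto simp: Hahn_set_def)

text \<open>Exhaustion is applied to \<open>- \<nu>\<close> within the class of sets all of whose
  measurable subsets have value at most 0. A set D outside the resulting union N with
  \<open>\<nu> D < 0\<close> would, by \<open>negative_subset\<close>, contain a member of that
  class with negative value, which the exhaustion excludes. The complement of N is then the positive
  side.\<close>

lemma Hahn_decomposition: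
  fixes \<nu> :: "'a set \<Rightarrow> real"
  assumes \<nu>: "countably_additive_on M \<nu>"
  obtains P where "Hahn_set M \<nu> P"
proof -
  define \<C> where "\<C> = {A \<in> sets M. \<forall>C\<in>sets M. C \<subseteq> A \<longrightarrow> \<nu> C \<le> 0}"
  obtain B :: "nat \<Rightarrow> 'a set" where B: "\<And>n. B n \<in> \<C>" "disjoint_family B"
      "\<And>n. 0 \<le> - \<nu> (B n)"
      "\<And>C. C \<in> \<C> \<Longrightarrow> C \<inter> (\<Union>n. B n) = {} \<Longrightarrow> - \<nu> C \<le> 0"
    by (rule countably_additive_on_exhaustion[OF countably_additive_on_uminus[OF \<nu>], of \<C>])
      (auto simp: \<C>_def countably_additive_on_empty[OF \<nu>])
  define N where "N = (\<Union>n. B n)"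
  have N: "N \<in> sets M"
    using B(1) by (auto simp: \<C>_def N_def)
  have pos: "0 \<le> \<nu> D" if D: "D \<in> sets M" "D \<inter> N = {}" for D
  proof -
    obtain A where A: "A \<in> sets M" "A \<subseteq> D" "\<nu> A \<le> \<nu> D" "\<And>C. C \<in> sets M \<Longrightarrow> C \<subseteq> A \<Longrightarrow> \<nu> C \<le> 0"
      by (rule negative_subset[OF \<nu> D(1)]) (rule that)
    then have "- \<nu> A \<le> 0"
      using D by (intro B(4)) (auto simp: \<C>_def N_def)
    then show ?thesis using A by linarith
  qed
  have neg: "\<nu> D \<le> 0" if D: "D \<in> sets M" "D \<subseteq> N" for D
  proof -
    have "(\<lambda>n. \<nu> (D \<inter> B n)) sums \<nu> (\<Union>n. D \<inter> B n)"
      using B D by (intro countably_additive_on_UN[OF \<nu>])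
        (auto simp: \<C>_def intro: disjoint_family_on_bisimulation[OF B(2)])
    moreover have "(\<Union>n. D \<inter> B n) = D"
      using D by (auto simp: N_def)
    moreover have "\<nu> (D \<inter> B n) \<le> 0" for n
      using B(1)[of n] D by (auto simp: \<C>_def)
    ultimately show ?thesis
      using sums_le[of "\<lambda>n. \<nu> (D \<inter> B n)" "\<lambda>_. 0" "\<nu> D" 0] by (metis sums_zero)
  qed
  show ?thesis
  proof (rule that[of "space M - N"], unfold Hahn_set_def, intro conjI ballI)
    show "space M - N \<in> sets M" using N by auto
    show "0 \<le> \<nu> (A \<inter> (space M - N))" if "A \<in> sets M" for A
      using that N by (intro pos) auto
    show "\<nu> (A - (space M - N)) \<le> 0" if "A \<in> sets M" for A
      using that N sets.sets_into_space[OF that] by (intro neg) auto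
  qed
qed

text \<open>The supremum over partitions is attained at the pair \<open>E \<inter> P\<close>,
  \<open>E - P\<close>. Any other partition loses by the triangle inequality when each piece is
  split along P.\<close>

lemma total_variation_Hahn:
  fixes \<nu> :: "'a set \<Rightarrow> real"
  assumes \<nu>: "countably_additive_on M \<nu>" and H: "Hahn_set M \<nu> P" and E: "E \<in> sets M"
  shows "total_variation M \<nu> E = ennreal (\<nu> (E \<inter> P) - \<nu> (E - P))"
proof (rule antisym)
  note P = Hahn_setD[OF H]
  show "total_variation M \<nu> E \<le> ennreal (\<nu> (E \<inter> P) - \<nu> (E - P))"
    unfolding total_variation_def
  proof (intro SUP_least, clarify)
    fix A :: "nat \<Rightarrow> 'a set" assume A: "range A \<subseteq> sets M" "disjoint_family A" "E = (\<Union>i. A i)"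
    have un: "E \<inter> P = (\<Union>i. A i \<inter> P)" "E - P = (\<Union>i. A i - P)"
      using A(3) by auto
    have s: "(\<lambda>i. \<nu> (A i \<inter> P) - \<nu> (A i - P)) sums (\<nu> (E \<inter> P) - \<nu> (E - P))"
      unfolding un using A P
      by (intro sums_diff countably_additive_on_UN[OF \<nu>]) (auto simp: disjoint_family_on_def)
    have "ennreal (norm (\<nu> (A i))) \<le> ennreal (\<nu> (A i \<inter> P) - \<nu> (A i - P))" for i
      using countably_additive_on_split[OF \<nu>, of "A i" P] P(2)[of "A i"] P(3)[of "A i"] A(1) P(1)
      by (intro ennreal_leI) auto
    then have "(\<Sum>i. ennreal (norm (\<nu> (A i)))) \<le> (\<Sum>i. ennreal (\<nu> (A i \<inter> P) - \<nu> (A i - P)))"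
      by (intro suminf_le) auto
    also have "\<dots> = ennreal (\<nu> (E \<inter> P) - \<nu> (E - P))"
    proof (rule suminf_ennreal_eq[OF _ s])
      show "0 \<le> \<nu> (A i \<inter> P) - \<nu> (A i - P)" for i
        using P(2)[of "A i"] P(3)[of "A i"] A(1) by auto
    qed
    finally show "(\<Sum>i. ennreal (norm (\<nu> (A i)))) \<le> ennreal (\<nu> ((\<Union>i. A i) \<inter> P) - \<nu> ((\<Union>i. A i) - P))"
      unfolding A(3) .
  qed
  let ?A = "binaryset (E \<inter> P) (E - P)"
  have "(\<lambda>i. ennreal (norm (\<nu> (?A i)))) sums (ennreal (norm (\<nu> (E \<inter> P))) + ennreal (norm (\<nu> (E - P))))"
    using countably_additive_on_empty[OF \<nu>] by (intro binaryset_sums) auto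
  moreover have "ennreal (norm (\<nu> (E \<inter> P))) + ennreal (norm (\<nu> (E - P))) = ennreal (\<nu> (E \<inter> P) - \<nu> (E - P))"
    using P(2,3)[OF E] by (simp flip: ennreal_plus)
  ultimately have "(\<Sum>i. ennreal (norm (\<nu> (?A i)))) = ennreal (\<nu> (E \<inter> P) - \<nu> (E - P))"
    using sums_unique by metis
  moreover have "(\<Sum>i. ennreal (norm (\<nu> (?A i)))) \<le> total_variation M \<nu> E"
    unfolding total_variation_def
  proof (rule SUP_upper, clarify, intro conjI)
    show "range ?A \<subseteq> sets M" using E P by (auto simp: range_binaryset_eq)
    show "disjoint_family ?A" by (intro disjoint_family_binaryset) auto
    show "(\<Union>i. ?A i) = E" by (auto simp: UN_binaryset_eq)
  qed
  ultimately show "ennreal (\<nu> (E \<inter> P) - \<nu> (E - P)) \<le> total_variation M \<nu> E"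
    by (simp only:)
qed

section \<open>The positive part as a finite measure\<close>

lemma sets_positive_part [simp, measurable_cong]: "sets (positive_part M \<nu>) = sets M"
  by (simp add: positive_part_def)

lemma space_positive_part [simp]: "space (positive_part M \<nu>) = space M"
  by (simp add: positive_part_def)

text \<open>\<open>measure_of\<close> returns the given set function only once that function is
  known to be countably additive. The Hahn set supplies this: on measurable sets, half of total
  variation plus \<open>\<nu>\<close> is \<open>\<nu> (E \<inter> P)\<close>.\<close>

lemma emeasure_positive_part:
  fixes \<nu> :: "'a set \<Rightarrow> real"
  assumes \<nu>: "countably_additive_on M \<nu>" and H: "Hahn_set M \<nu> P" and E: "E \<in> sets M"
  shows "emeasure (positive_part M \<nu>) E = ennreal (\<nu> (E \<inter> P))"
proof -
  note P = Hahn_setD[OF H]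
  let ?f = "\<lambda>E. ennreal ((enn2real (total_variation M \<nu> E) + \<nu> E) / 2)"
  have f: "?f A = ennreal (\<nu> (A \<inter> P))" if "A \<in> sets M" for A
  proof -
    have "enn2real (total_variation M \<nu> A) = \<nu> (A \<inter> P) - \<nu> (A - P)"
      unfolding total_variation_Hahn[OF \<nu> H that]
      using P(2,3)[OF that] by (intro enn2real_ennreal) linarith
    then have "enn2real (total_variation M \<nu> A) + \<nu> A = \<nu> (A \<inter> P) * 2"
      using countably_additive_on_split[OF \<nu> that P(1)] by linarith
    then show ?thesis by simp
  qed
  have "positive (sets M) ?f"
    using f[of "{}"] countably_additive_on_empty[OF \<nu>] by (auto simp: positive_def)
  moreover have "countably_additive (sets M) ?f"
  proof (rule countably_additiveI)
    fix A :: "nat \<Rightarrow> 'a set"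
    assume A: "range A \<subseteq> sets M" "disjoint_family A" "\<Union> (range A) \<in> sets M"
    have "(\<lambda>i. \<nu> (A i \<inter> P)) sums \<nu> (\<Union>i. A i \<inter> P)"
      using A P by (intro countably_additive_on_UN[OF \<nu>]) (auto simp: disjoint_family_on_def)
    then have "(\<Sum>i. ennreal (\<nu> (A i \<inter> P))) = ennreal (\<nu> (\<Union>i. A i \<inter> P))"
      using P(2) A(1) by (intro suminf_ennreal_eq) auto
    moreover have "?f (A i) = ennreal (\<nu> (A i \<inter> P))" for i
      using A(1) by (intro f) auto
    moreover have "(\<Union>i. A i \<inter> P) = \<Union> (range A) \<inter> P"
      by auto
    ultimately show "(\<Sum>i. ?f (A i)) = ?f (\<Union> (range A))"
      using f[OF A(3)] by simp
  qed
  ultimately have "emeasure (positive_part M \<nu>) E = ?f E"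
    by (intro emeasure_measure_of[OF positive_part_def])
      (simp_all add: sets.space_closed E)
  also have "\<dots> = ennreal (\<nu> (E \<inter> P))"
    by (rule f[OF E])
  finally show ?thesis .
qed

lemma finite_measure_positive_part:
  fixes \<nu> :: "'a set \<Rightarrow> real"
  assumes "countably_additive_on M \<nu>"
  shows "finite_measure (positive_part M \<nu>)"
proof -
  obtain P where H: "Hahn_set M \<nu> P"
    by (rule Hahn_decomposition[OF assms]) (rule that)
  show ?thesis
    by (intro finite_measureI) (simp add: emeasure_positive_part[OF assms H sets.top])
qed

lemma Jordan_decomposition:
  fixes \<nu> :: "'a set \<Rightarrow> real"
  assumes \<nu>: "countably_additive_on M \<nu>" and E: "E \<in> sets M"
  shows "\<nu> E = measure (positive_part M \<nu>) E - measure (positive_part M (\<lambda>E. - \<nu> E)) E"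
proof -
  obtain P where H: "Hahn_set M \<nu> P"
    by (rule Hahn_decomposition[OF \<nu>]) (rule that)
  note P = Hahn_setD[OF H]
  \<comment> \<open>The complement of P is a Hahn set for \<open>- \<nu>\<close>, so the negative
    part is read off on the portion of E outside P.\<close>
  have eq: "A \<inter> (space M - P) = A - P" "A - (space M - P) = A \<inter> P" if "A \<in> sets M" for A
    using sets.sets_into_space[OF that] by auto
  have H': "Hahn_set M (\<lambda>E. - \<nu> E) (space M - P)"
    using P by (auto simp: Hahn_set_def eq)
  have "emeasure (positive_part M (\<lambda>E. - \<nu> E)) E = ennreal (- \<nu> (E \<inter> (space M - P)))"
    by (intro emeasure_positive_part countably_additive_on_uminus[OF \<nu>] H' E)
  moreover have "emeasure (positive_part M \<nu>) E = ennreal (\<nu> (E \<inter> P))"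
    by (intro emeasure_positive_part \<nu> H E)
  ultimately have "measure (positive_part M (\<lambda>E. - \<nu> E)) E = - \<nu> (E - P)"
      "measure (positive_part M \<nu>) E = \<nu> (E \<inter> P)"
    using P(2,3)[OF E] by (simp_all add: measure_def eq(1)[OF E])
  then show ?thesis
    using countably_additive_on_split[OF \<nu> E P(1)] by linarith
qed

lemma countably_additive_on_measure:
  assumes "finite_measure N" "sets N = sets M"
  shows "countably_additive_on M (measure N)"
  unfolding countably_additive_on_def assms(2)[symmetric]
  using finite_measure.finite_measure_UNION[OF assms(1)] by blast

text \<open>For a positive measure the whole space is a Hahn set.\<close>

lemma positive_part_measure:
  assumes "finite_measure N" "sets N = sets M"
  shows "positive_part M (measure N) = N"
proof (rule measure_eqI)
  fix A assume A: "A \<in> sets (positive_part M (measure N))"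
  interpret finite_measure N by fact
  have "emeasure (positive_part M (measure N)) A = ennreal (measure N (A \<inter> space M))"
    using A by (intro emeasure_positive_part countably_additive_on_measure assms)
      (auto simp: Hahn_set_def sets.sets_into_space Diff_eq_empty_iff[THEN iffD2])
  then show "emeasure (positive_part M (measure N)) A = emeasure N A"
    using A sets.sets_into_space[of A M] by (simp add: inf.absorb1 emeasure_eq_measure)
qed (use assms in auto)

text \<open>The subtracted integral disappears because the empty set is a Hahn set for the negated
  measure, whose positive part is therefore null.\<close>

lemma real_measure_integral_measure:
  assumes "finite_measure N" "sets N = sets M"
  shows "real_measure_integral M (measure N) f = (\<integral>x. f x \<partial>N)"
proof -
  have "emeasure (positive_part M (\<lambda>E. - measure N E)) A = 0" if "A \<in> sets M" for A
    using that by (subst emeasure_positive_part[where P = "{}"])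
      (auto simp: Hahn_set_def intro!: countably_additive_on_uminus countably_additive_on_measure assms)
  then have "positive_part M (\<lambda>E. - measure N E) = null_measure M"
    by (intro measure_eqI) auto
  then show ?thesis
    by (simp add: real_measure_integral_def positive_part_measure[OF assms])
qed

section \<open>Integration against complex measures\<close>

text \<open>The bound is imposed on \<open>space M\<close> only: characters are bounded on the torus
  but not on the ambient vector space.\<close>

definition bounded_measurable :: "'a measure \<Rightarrow> ('a \<Rightarrow> complex) set" where
  "bounded_measurable M = {f \<in> borel_measurable M. \<exists>C. \<forall>x\<in>space M. norm (f x) \<le> C}"

lemma bounded_measurableI:
  "f \<in> borel_measurable M \<Longrightarrow> (\<And>x. x \<in> space M \<Longrightarrow> norm (f x) \<le> C) \<Longrightarrow> f \<in> bounded_measurable M"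
  by (auto simp: bounded_measurable_def)

lemma bounded_measurableE:
  assumes "f \<in> bounded_measurable M"
  obtains C where "f \<in> borel_measurable M" "0 \<le> C" "\<And>x. x \<in> space M \<Longrightarrow> norm (f x) \<le> C"
proof -
  obtain C where C: "\<forall>x\<in>space M. norm (f x) \<le> C" and f: "f \<in> borel_measurable M"
    using assms unfolding bounded_measurable_def by blast
  have "norm (f x) \<le> max C 0" if "x \<in> space M" for x
    using C that by (auto intro: max.coboundedI1)
  then show ?thesis
    by (intro that[of "max C 0"] f) auto
qed

lemma bounded_measurable_measurable: "f \<in> bounded_measurable M \<Longrightarrow> f \<in> borel_measurable M"
  by (simp add: bounded_measurable_def)

lemma bounded_measurable_const: "(\<lambda>_. c) \<in> bounded_measurable M"
  by (rule bounded_measurableI[of _ _ "norm c"]) auto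

lemma bounded_measurable_indicator: "A \<in> sets M \<Longrightarrow> indicator A \<in> bounded_measurable M"
  by (rule bounded_measurableI[of _ _ 1]) (auto simp: indicator_def)

lemma bounded_measurable_add:
  assumes "f \<in> bounded_measurable M" "g \<in> bounded_measurable M"
  shows "(\<lambda>x. f x + g x) \<in> bounded_measurable M"
proof -
  obtain C where f: "f \<in> borel_measurable M" "0 \<le> C" "\<And>x. x \<in> space M \<Longrightarrow> norm (f x) \<le> C"
    using assms(1) by (rule bounded_measurableE) (rule that)
  obtain D where g: "g \<in> borel_measurable M" "0 \<le> D" "\<And>x. x \<in> space M \<Longrightarrow> norm (g x) \<le> D"
    using assms(2) by (rule bounded_measurableE) (rule that)
  show ?thesis
    using f g by (intro bounded_measurableI[of _ _ "C + D"] norm_triangle_mono) auto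
qed

lemma bounded_measurable_mult:
  assumes "f \<in> bounded_measurable M" "g \<in> bounded_measurable M"
  shows "(\<lambda>x. f x * g x) \<in> bounded_measurable M"
proof -
  obtain C where f: "f \<in> borel_measurable M" "0 \<le> C" "\<And>x. x \<in> space M \<Longrightarrow> norm (f x) \<le> C"
    using assms(1) by (rule bounded_measurableE) (rule that)
  obtain D where g: "g \<in> borel_measurable M" "0 \<le> D" "\<And>x. x \<in> space M \<Longrightarrow> norm (g x) \<le> D"
    using assms(2) by (rule bounded_measurableE) (rule that)
  show ?thesis
    using f g by (intro bounded_measurableI[of _ _ "C * D"]) (auto simp: norm_mult intro!: mult_mono)
qed

lemma bounded_measurable_cong:
  assumes "f \<in> bounded_measurable M" "\<And>x. x \<in> space M \<Longrightarrow> g x = f x"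
  shows "g \<in> bounded_measurable M"
proof -
  have "g \<in> borel_measurable M \<longleftrightarrow> f \<in> borel_measurable M"
    using assms(2) by (rule measurable_cong)
  then show ?thesis
    using assms by (auto simp: bounded_measurable_def)
qed

lemma bounded_measurable_sum:
  "(\<And>i. i \<in> I \<Longrightarrow> f i \<in> bounded_measurable M) \<Longrightarrow> (\<lambda>x. \<Sum>i\<in>I. f i x) \<in> bounded_measurable M"
  by (induction I rule: infinite_finite_induct)
    (auto intro: bounded_measurable_const bounded_measurable_add)

lemma integrable_bounded_measurable:
  assumes "finite_measure N" "sets N = sets M" "f \<in> bounded_measurable M"
  shows "integrable N f"
proof -
  obtain C where f: "f \<in> borel_measurable M" "0 \<le> C" "\<And>x. x \<in> space M \<Longrightarrow> norm (f x) \<le> C"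
    using assms(3) by (rule bounded_measurableE) (rule that)
  then show ?thesis
    using sets_eq_imp_space_eq[OF assms(2)]
    by (intro finite_measure.integrable_const_bound[OF assms(1), of _ C])
      (auto simp: measurable_cong_sets[OF assms(2) refl])
qed

text \<open>The functionals \<open>f \<mapsto> \<integral> f d\<mu>\<close> for complex \<open>\<mu>\<close>, abstracted to what the uniqueness argument
  needs: linearity and bounded pointwise convergence.\<close>

definition sigma_functional :: "'a measure \<Rightarrow> (('a \<Rightarrow> complex) \<Rightarrow> complex) \<Rightarrow> bool" where
  "sigma_functional M L \<longleftrightarrow>
     (\<forall>f g. f \<in> bounded_measurable M \<longrightarrow> g \<in> bounded_measurable M \<longrightarrow>
        L (\<lambda>x. f x + g x) = L f + L g) \<and>
     (\<forall>c f. f \<in> bounded_measurable M \<longrightarrow> L (\<lambda>x. c * f x) = c * L f) \<and>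
     (\<forall>F f C. (\<forall>n. F n \<in> borel_measurable M) \<longrightarrow> (\<forall>n. \<forall>x\<in>space M. norm (F n x) \<le> C) \<longrightarrow>
        (\<forall>x\<in>space M. (\<lambda>n. F n x) \<longlonglongrightarrow> f x) \<longrightarrow> (\<lambda>n. L (F n)) \<longlonglongrightarrow> L f)"

lemma sigma_functionalI:
  assumes "\<And>f g. f \<in> bounded_measurable M \<Longrightarrow> g \<in> bounded_measurable M \<Longrightarrow>
      L (\<lambda>x. f x + g x) = L f + L g"
    "\<And>c f. f \<in> bounded_measurable M \<Longrightarrow> L (\<lambda>x. c * f x) = c * L f"
    "\<And>F f C. (\<And>n. F n \<in> borel_measurable M) \<Longrightarrow> (\<And>n x. x \<in> space M \<Longrightarrow> norm (F n x) \<le> C) \<Longrightarrow>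
      (\<And>x. x \<in> space M \<Longrightarrow> (\<lambda>n. F n x) \<longlonglongrightarrow> f x) \<Longrightarrow> (\<lambda>n. L (F n)) \<longlonglongrightarrow> L f"
  shows "sigma_functional M L"
  unfolding sigma_functional_def by (intro conjI allI impI assms) auto

lemma sigma_functional_add:
  "sigma_functional M L \<Longrightarrow> f \<in> bounded_measurable M \<Longrightarrow> g \<in> bounded_measurable M \<Longrightarrow>
    L (\<lambda>x. f x + g x) = L f + L g"
  by (simp add: sigma_functional_def)

lemma sigma_functional_scale:
  "sigma_functional M L \<Longrightarrow> f \<in> bounded_measurable M \<Longrightarrow> L (\<lambda>x. c * f x) = c * L f"
  by (simp add: sigma_functional_def)

lemma sigma_functional_lim:
  assumes "sigma_functional M L" "\<And>n. F n \<in> borel_measurable M"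
    "\<And>n x. x \<in> space M \<Longrightarrow> norm (F n x) \<le> C" "\<And>x. x \<in> space M \<Longrightarrow> (\<lambda>n. F n x) \<longlonglongrightarrow> f x"
  shows "(\<lambda>n. L (F n)) \<longlonglongrightarrow> L f"
  using assms unfolding sigma_functional_def by blast

text \<open>The convergence clause is applied to the constant sequence f, whose pointwise limit on
  \<open>space M\<close> is g as well. Values outside the space thus have no influence.\<close>

lemma sigma_functional_cong:
  assumes L: "sigma_functional M L" and f: "f \<in> bounded_measurable M"
    and eq: "\<And>x. x \<in> space M \<Longrightarrow> g x = f x"
  shows "L g = L f"
proof -
  obtain C where C: "f \<in> borel_measurable M" "0 \<le> C" "\<And>x. x \<in> space M \<Longrightarrow> norm (f x) \<le> C"
    using f by (rule bounded_measurableE) (rule that)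
  have "(\<lambda>n::nat. L f) \<longlonglongrightarrow> L g"
    using C eq by (intro sigma_functional_lim[OF L]) auto
  then show ?thesis
    by (simp add: LIMSEQ_const_iff)
qed

lemma sigma_functional_sum:
  assumes L: "sigma_functional M L" and "\<And>i. i \<in> I \<Longrightarrow> f i \<in> bounded_measurable M"
  shows "L (\<lambda>x. \<Sum>i\<in>I. f i x) = (\<Sum>i\<in>I. L (f i))"
proof -
  have zero: "L (\<lambda>x. 0) = 0"
    using sigma_functional_scale[OF L bounded_measurable_const[of 0], of 0] by simp
  show ?thesis
    using assms(2)
    by (induction I rule: infinite_finite_induct)
      (auto simp: zero sigma_functional_add[OF L] bounded_measurable_sum)
qed

lemma sigma_functional_integral:
  assumes "finite_measure N" "sets N = sets M"
  shows "sigma_functional M (\<lambda>f. \<integral>x. f x \<partial>N)"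
proof (rule sigma_functionalI)
  interpret finite_measure N by fact
  have sp: "space N = space M"
    by (rule sets_eq_imp_space_eq) fact
  show "(\<integral>x. f x + g x \<partial>N) = (\<integral>x. f x \<partial>N) + (\<integral>x. g x \<partial>N)"
    if "f \<in> bounded_measurable M" "g \<in> bounded_measurable M" for f g
    using that by (intro Bochner_Integration.integral_add integrable_bounded_measurable[OF assms])
  show "(\<integral>x. c * f x \<partial>N) = c * (\<integral>x. f x \<partial>N)" for c and f :: "'a \<Rightarrow> complex"
    by simp
  fix F :: "nat \<Rightarrow> 'a \<Rightarrow> complex" and f C
  assume F: "\<And>n. F n \<in> borel_measurable M" "\<And>n x. x \<in> space M \<Longrightarrow> norm (F n x) \<le> C"
    "\<And>x. x \<in> space M \<Longrightarrow> (\<lambda>n. F n x) \<longlonglongrightarrow> f x"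
  have Fm: "F n \<in> borel_measurable N" for n
    using F(1)[of n] by (simp add: measurable_cong_sets[OF assms(2) refl])
  have "f \<in> borel_measurable N"
    using F(3) sp by (intro borel_measurable_LIMSEQ_metric[OF Fm]) auto
  then show "(\<lambda>n. \<integral>x. F n x \<partial>N) \<longlonglongrightarrow> (\<integral>x. f x \<partial>N)"
    using F(2,3) sp Fm by (intro integral_dominated_convergence[where w = "\<lambda>_. C"]) auto
qed

lemma sigma_functional_plus:
  assumes "sigma_functional M K" "sigma_functional M L"
  shows "sigma_functional M (\<lambda>f. K f + L f)"
proof (rule sigma_functionalI)
  show "(\<lambda>n. K (F n) + L (F n)) \<longlonglongrightarrow> K f + L f"
    if "\<And>n. F n \<in> borel_measurable M" "\<And>n x. x \<in> space M \<Longrightarrow> norm (F n x) \<le> C"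
      "\<And>x. x \<in> space M \<Longrightarrow> (\<lambda>n. F n x) \<longlonglongrightarrow> f x" for F f C
    by (intro tendsto_add sigma_functional_lim[OF assms(1)] sigma_functional_lim[OF assms(2)])
      (fact that)+
qed (use assms in \<open>simp_all add: sigma_functional_add sigma_functional_scale algebra_simps\<close>)

lemma sigma_functional_times:
  assumes "sigma_functional M L"
  shows "sigma_functional M (\<lambda>f. c * L f)"
proof (rule sigma_functionalI)
  show "(\<lambda>n. c * L (F n)) \<longlonglongrightarrow> c * L f"
    if "\<And>n. F n \<in> borel_measurable M" "\<And>n x. x \<in> space M \<Longrightarrow> norm (F n x) \<le> C"
      "\<And>x. x \<in> space M \<Longrightarrow> (\<lambda>n. F n x) \<longlonglongrightarrow> f x" for F f C
    by (intro tendsto_mult tendsto_const sigma_functional_lim[OF assms]) (fact that)+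
qed (use assms in \<open>simp_all add: sigma_functional_add sigma_functional_scale algebra_simps\<close>)

lemma sigma_functional_minus:
  assumes "sigma_functional M K" "sigma_functional M L"
  shows "sigma_functional M (\<lambda>f. K f - L f)"
  using sigma_functional_plus[OF assms(1) sigma_functional_times[OF assms(2), of "- 1"]] by simp

text \<open>Passage to the measure with density g. It is applied with g a character, the
  trigonometric density, or the indicator of an invariant set.\<close>

lemma sigma_functional_mult:
  assumes L: "sigma_functional M L" and g: "g \<in> bounded_measurable M"
  shows "sigma_functional M (\<lambda>f. L (\<lambda>x. f x * g x))"
proof (rule sigma_functionalI)
  show "L (\<lambda>x. (f x + f' x) * g x) = L (\<lambda>x. f x * g x) + L (\<lambda>x. f' x * g x)"
    if "f \<in> bounded_measurable M" "f' \<in> bounded_measurable M" for f f'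
    unfolding distrib_right
    by (intro sigma_functional_add[OF L] bounded_measurable_mult that g)
  show "L (\<lambda>x. c * f x * g x) = c * L (\<lambda>x. f x * g x)" if "f \<in> bounded_measurable M" for c f
    unfolding mult.assoc by (intro sigma_functional_scale[OF L] bounded_measurable_mult that g)
  fix F :: "nat \<Rightarrow> 'a \<Rightarrow> complex" and f C
  assume F: "\<And>n. F n \<in> borel_measurable M" "\<And>n x. x \<in> space M \<Longrightarrow> norm (F n x) \<le> C"
    "\<And>x. x \<in> space M \<Longrightarrow> (\<lambda>n. F n x) \<longlonglongrightarrow> f x"
  obtain D where D: "g \<in> borel_measurable M" "0 \<le> D" "\<And>x. x \<in> space M \<Longrightarrow> norm (g x) \<le> D"
    using g by (rule bounded_measurableE) (rule that)
  show "(\<lambda>n. L (\<lambda>x. F n x * g x)) \<longlonglongrightarrow> L (\<lambda>x. f x * g x)"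
  proof (rule sigma_functional_lim[OF L])
    show "(\<lambda>x. F n x * g x) \<in> borel_measurable M" for n
      using F(1) D(1) by simp
    show "norm (F n x * g x) \<le> C * D" if x: "x \<in> space M" for n x
      unfolding norm_mult using F(2)[OF x, of n] D(3)[OF x] D(2)
        order_trans[OF norm_ge_zero F(2)[OF x]]
      by (intro mult_mono) auto
    show "(\<lambda>n. F n x * g x) \<longlonglongrightarrow> f x * g x" if "x \<in> space M" for x
      using F(3)[OF that] by (intro tendsto_intros)
  qed
qed

section \<open>The integral of a complex measure as a functional\<close>

lemma countably_additive_on_Re: "complex_measure M \<mu> \<Longrightarrow> countably_additive_on M (\<lambda>E. Re (\<mu> E))"
  and countably_additive_on_Im: "complex_measure M \<mu> \<Longrightarrow> countably_additive_on M (\<lambda>E. Im (\<mu> E))"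
  unfolding countably_additive_on_def by (auto intro: sums_Re sums_Im)

lemma sigma_functional_real_measure_integral:
  "countably_additive_on M \<nu> \<Longrightarrow> sigma_functional M (real_measure_integral M \<nu>)"
  unfolding real_measure_integral_def[abs_def]
  by (intro sigma_functional_minus sigma_functional_integral finite_measure_positive_part
      countably_additive_on_uminus sets_positive_part)

lemma sigma_functional_complex_measure_integral:
  "complex_measure M \<mu> \<Longrightarrow> sigma_functional M (complex_measure_integral M \<mu>)"
  unfolding complex_measure_integral_def[abs_def]
  by (intro sigma_functional_plus sigma_functional_times sigma_functional_real_measure_integral
      countably_additive_on_Re countably_additive_on_Im)

lemma real_measure_integral_indicator:
  assumes \<nu>: "countably_additive_on M \<nu>" and A: "A \<in> sets M"
  shows "real_measure_integral M \<nu> (indicator A) = of_real (\<nu> A)"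
proof -
  have "(\<integral>x. indicator A x \<partial>positive_part M \<nu>) = complex_of_real (measure (positive_part M \<nu>) A)"
    if "countably_additive_on M \<nu>" for \<nu>
  proof -
    interpret finite_measure "positive_part M \<nu>"
      by (rule finite_measure_positive_part[OF that])
    have "has_bochner_integral (positive_part M \<nu>) (\<lambda>x. indicator A x *\<^sub>R (1::complex))
        (measure (positive_part M \<nu>) A *\<^sub>R 1)"
      using A by (intro has_bochner_integral_indicator) (auto simp: less_top[symmetric])
    moreover have "(\<lambda>x. indicator A x *\<^sub>R (1::complex)) = indicator A"
      by (auto simp: indicator_def)
    ultimately show ?thesis
      by (simp add: has_bochner_integral_integral_eq scaleR_conv_of_real)
  qed
  from this[OF \<nu>] this[OF countably_additive_on_uminus[OF \<nu>]] show ?thesis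
    by (simp add: real_measure_integral_def Jordan_decomposition[OF \<nu> A])
qed

text \<open>The way back from functionals to set functions: a functional that kills indicators comes
  from a measure that kills sets.\<close>

lemma complex_measure_integral_indicator:
  assumes "complex_measure M \<mu>" "A \<in> sets M"
  shows "complex_measure_integral M \<mu> (indicator A) = \<mu> A"
  unfolding complex_measure_integral_def
  by (simp add: real_measure_integral_indicator assms countably_additive_on_Re
      countably_additive_on_Im complex_eq_iff)

section \<open>Uniqueness of Fourier coefficients\<close>

lemma space_torus_borel [simp]: "space torus_borel = torus"
  by (simp add: torus_borel_def space_restrict_space)

lemma closed_torus: "closed (torus :: (complex ^ 'n) set)"
  unfolding torus_def by (intro closed_Collect_all closed_Collect_eq continuous_intros)

lemma compact_torus: "compact (torus :: (complex ^ 'n::finite) set)"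
proof -
  have "norm \<xi> \<le> real CARD('n)" if "\<xi> \<in> torus" for \<xi> :: "complex ^ 'n"
    using L2_set_le_sum[of UNIV "\<lambda>i. norm (\<xi> $ i)"] that by (simp add: torus_def norm_vec_def)
  then have "bounded (torus :: (complex ^ 'n) set)"
    by (rule boundedI)
  then show ?thesis
    using closed_torus by (simp add: compact_eq_bounded_closed)
qed

lemma torus_norm_nth: "\<xi> \<in> torus \<Longrightarrow> norm (\<xi> $ i) = 1"
  by (simp add: torus_def)

lemma torus_nonzero: "\<xi> \<in> torus \<Longrightarrow> \<xi> $ i \<noteq> 0"
  using torus_norm_nth[of \<xi> i] by auto

lemma measurable_torus_borel_continuous:
  "continuous_on UNIV f \<Longrightarrow> f \<in> borel_measurable torus_borel"
  unfolding torus_borel_def by (intro measurable_restrict_space1 borel_measurable_continuous_onI)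

lemma measurable_nth_torus_borel [measurable]: "(\<lambda>\<xi>. \<xi> $ i) \<in> borel_measurable torus_borel"
  by (intro measurable_torus_borel_continuous continuous_intros)

section \<open>Characters of the torus\<close>

lemma borel_measurable_powi [measurable (raw)]:
  fixes f :: "'a \<Rightarrow> complex"
  assumes "f \<in> borel_measurable M"
  shows "(\<lambda>x. f x powi k) \<in> borel_measurable M"
  using assms unfolding power_int_def by (cases "k \<ge> 0") simp_all

text \<open>The coordinates are conjugated so that integrating \<open>torus_char k\<close> gives the
  Fourier coefficient at k itself, not at \<open>- k\<close>.\<close>

definition torus_char :: "int ^ 'n \<Rightarrow> complex ^ 'n \<Rightarrow> complex" where
  "torus_char k \<xi> = (\<Prod>i\<in>UNIV. cnj (\<xi> $ i) powi (k $ i))"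

lemma measurable_torus_char [measurable]: "torus_char k \<in> borel_measurable torus_borel"
  unfolding torus_char_def[abs_def]
  by (intro borel_measurable_prod borel_measurable_powi measurable_torus_borel_continuous
      continuous_intros)

lemma continuous_on_torus_char: "continuous_on torus (torus_char k)"
  unfolding torus_char_def[abs_def]
  by (intro continuous_intros) (auto simp: torus_nonzero)

lemma norm_torus_char: "\<xi> \<in> torus \<Longrightarrow> norm (torus_char k \<xi>) = 1"
  by (simp add: torus_char_def torus_norm_nth prod_norm[symmetric] norm_power_int)

lemma bounded_measurable_torus_char: "torus_char k \<in> bounded_measurable torus_borel"
  by (rule bounded_measurableI[of _ _ 1]) (auto simp: norm_torus_char)

lemma torus_char_add:
  "\<xi> \<in> torus \<Longrightarrow> torus_char (k + l) \<xi> = torus_char k \<xi> * torus_char l \<xi>"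
  by (simp add: torus_char_def power_int_add torus_nonzero prod.distrib)

lemma torus_char_0: "torus_char 0 \<xi> = 1"
  by (simp add: torus_char_def)

lemma torus_char_uminus: "torus_char (- k) \<xi> = inverse (torus_char k \<xi>)"
  by (simp add: torus_char_def power_int_minus prod_inversef[symmetric] o_def)

lemma torus_char_axis: "torus_char (axis i 1) \<xi> = cnj (\<xi> $ i)"
proof -
  have "torus_char (axis i 1) \<xi> = (\<Prod>j\<in>UNIV. if j = i then cnj (\<xi> $ i) else 1)"
    unfolding torus_char_def by (intro prod.cong refl) (auto simp: axis_def)
  then show ?thesis by simp
qed

section \<open>Trigonometric polynomials and their density\<close>

lemma cnj_eq_inverse: "norm z = 1 \<Longrightarrow> cnj z = inverse z"
  by (metis complex_norm_square inverse_unique mult.commute of_real_1 one_power2)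

text \<open>The rule \<open>cong\<close> identifies functions agreeing on the torus. Closure under
  products depends on it, since \<open>torus_char (k + l)\<close> factors only where no coordinate
  vanishes.\<close>

inductive_set trig_poly :: "(complex ^ 'n \<Rightarrow> complex) set" where
  char: "torus_char k \<in> trig_poly"
| add: "f \<in> trig_poly \<Longrightarrow> g \<in> trig_poly \<Longrightarrow> (\<lambda>\<xi>. f \<xi> + g \<xi>) \<in> trig_poly"
| scale: "f \<in> trig_poly \<Longrightarrow> (\<lambda>\<xi>. c * f \<xi>) \<in> trig_poly"
| cong: "f \<in> trig_poly \<Longrightarrow> (\<And>\<xi>. \<xi> \<in> torus \<Longrightarrow> g \<xi> = f \<xi>) \<Longrightarrow> g \<in> trig_poly"

lemma trig_poly_const: "(\<lambda>_. c) \<in> trig_poly"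
  using trig_poly.scale[OF trig_poly.char, of c 0] by (simp add: torus_char_0)

lemma trig_poly_mult:
  assumes "f \<in> trig_poly" "g \<in> trig_poly"
  shows "(\<lambda>\<xi>. f \<xi> * g \<xi>) \<in> trig_poly"
  using assms
proof (induction f)
  case (char k)
  from char show ?case
  proof (induction g)
    case (char l)
    show ?case
      by (rule trig_poly.cong[OF trig_poly.char[of "k + l"]]) (simp add: torus_char_add)
  next
    case (add f g)
    then show ?case by (simp add: distrib_left trig_poly.add)
  next
    case (scale f c)
    from trig_poly.scale[OF scale.IH, of c] show ?case by (simp add: mult.left_commute)
  next
    case (cong f g)
    show ?case by (rule trig_poly.cong[OF cong.IH]) (simp add: cong.hyps)
  qed
next
  case (add f h)
  then show ?case by (simp add: distrib_right trig_poly.add)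
next
  case (scale f c)
  from trig_poly.scale[OF scale.IH[OF scale.prems], of c] show ?case by (simp add: mult.assoc)
next
  case (cong f h)
  show ?case by (rule trig_poly.cong[OF cong.IH[OF cong.prems]]) (simp add: cong.hyps)
qed

lemma trig_poly_bounded_measurable:
  "f \<in> trig_poly \<Longrightarrow> f \<in> bounded_measurable torus_borel"
proof (induction rule: trig_poly.induct)
  case (cong f g)
  show ?case by (rule bounded_measurable_cong[OF cong.IH]) (simp add: cong.hyps)
qed (auto intro: bounded_measurable_torus_char bounded_measurable_add bounded_measurable_mult
    bounded_measurable_const)

lemma trig_poly_continuous: "f \<in> trig_poly \<Longrightarrow> continuous_on torus f"
proof (induction rule: trig_poly.induct)
  case (cong f g)
  have "continuous_on torus g \<longleftrightarrow> continuous_on torus f"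
    using cong.hyps by (intro continuous_on_cong) auto
  then show ?case using cong.IH by simp
qed (auto intro: continuous_on_torus_char continuous_intros)

text \<open>On the torus a coordinate is the inverse of its conjugate, hence a character; real and
  imaginary part are the usual combinations of the two. They supply the separation of points for
  Stone-Weierstrass.\<close>

lemma trig_poly_coordinate:
  "(\<lambda>\<xi>. complex_of_real (Re (\<xi> $ i))) \<in> trig_poly" "(\<lambda>\<xi>. complex_of_real (Im (\<xi> $ i))) \<in> trig_poly"
proof -
  have cnj: "(\<lambda>\<xi>. cnj (\<xi> $ i)) \<in> trig_poly"
    using trig_poly.char[of "axis i 1"] by (simp add: torus_char_axis[abs_def])
  have id: "(\<lambda>\<xi>. \<xi> $ i) \<in> trig_poly"
    by (rule trig_poly.cong[OF trig_poly.char[of "- axis i 1"]])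
      (simp add: torus_char_uminus torus_char_axis torus_def flip: cnj_eq_inverse)
  show "(\<lambda>\<xi>. complex_of_real (Re (\<xi> $ i))) \<in> trig_poly"
    by (rule trig_poly.cong[OF trig_poly.scale[OF trig_poly.add[OF id cnj], of "1/2"]])
      (simp add: complex_eq_iff)
  show "(\<lambda>\<xi>. complex_of_real (Im (\<xi> $ i))) \<in> trig_poly"
    by (rule trig_poly.cong[OF trig_poly.add[OF trig_poly.scale[OF id, of "- \<i> / 2"]
          trig_poly.scale[OF cnj, of "\<i> / 2"]]])
      (simp add: complex_eq_iff)
qed

text \<open>Real Stone-Weierstrass, for the ring of real functions whose complexification is a
  trigonometric polynomial. The approximant obtained is therefore itself real-valued.\<close>

lemma trig_poly_dense:
  fixes f :: "complex ^ 'n::finite \<Rightarrow> real"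
  assumes "continuous_on torus f" "e > 0"
  obtains g where "g \<in> trig_poly" "\<And>\<xi>. \<xi> \<in> torus \<Longrightarrow> norm (complex_of_real (f \<xi>) - g \<xi>) < e"
proof -
  interpret function_ring_on "{f. (\<lambda>\<xi>. complex_of_real (f \<xi>)) \<in> trig_poly}" "torus :: (complex ^ 'n) set"
  proof
    fix f assume "f \<in> {f :: complex ^ 'n \<Rightarrow> real. (\<lambda>\<xi>. complex_of_real (f \<xi>)) \<in> trig_poly}"
    then have "continuous_on torus (\<lambda>\<xi>. Re (complex_of_real (f \<xi>)))"
      by (intro continuous_on_Re trig_poly_continuous) auto
    then show "continuous_on torus f" by simp
  next
    fix x y :: "complex ^ 'n" assume "x \<noteq> y"
    then obtain i where "x $ i \<noteq> y $ i" by (auto simp: vec_eq_iff)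
    then consider "Re (x $ i) \<noteq> Re (y $ i)" | "Im (x $ i) \<noteq> Im (y $ i)"
      by (auto simp: complex_eq_iff)
    then show "\<exists>f\<in>{f. (\<lambda>\<xi>. complex_of_real (f \<xi>)) \<in> trig_poly}. f x \<noteq> f y"
    proof cases
      case 1
      then show ?thesis
        by (intro bexI[of _ "\<lambda>\<xi>. Re (\<xi> $ i)"]) (simp_all add: trig_poly_coordinate)
    next
      case 2
      then show ?thesis
        by (intro bexI[of _ "\<lambda>\<xi>. Im (\<xi> $ i)"]) (simp_all add: trig_poly_coordinate)
    qed
  next
    fix f g :: "complex ^ 'n \<Rightarrow> real"
    assume fg: "f \<in> {f. (\<lambda>\<xi>. complex_of_real (f \<xi>)) \<in> trig_poly}"
      "g \<in> {f. (\<lambda>\<xi>. complex_of_real (f \<xi>)) \<in> trig_poly}"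
    from fg show "(\<lambda>\<xi>. f \<xi> + g \<xi>) \<in> {f. (\<lambda>\<xi>. complex_of_real (f \<xi>)) \<in> trig_poly}"
      unfolding mem_Collect_eq of_real_add by (rule trig_poly.add)
    from fg show "(\<lambda>\<xi>. f \<xi> * g \<xi>) \<in> {f. (\<lambda>\<xi>. complex_of_real (f \<xi>)) \<in> trig_poly}"
      unfolding mem_Collect_eq of_real_mult by (rule trig_poly_mult)
  qed (simp_all add: compact_torus trig_poly_const)
  obtain g where g: "(\<lambda>\<xi>. complex_of_real (g \<xi>)) \<in> trig_poly" "\<forall>\<xi>\<in>torus. \<bar>f \<xi> - g \<xi>\<bar> < e"
    using Stone_Weierstrass_basic[OF assms] by auto
  show ?thesis
  proof (rule that[OF g(1)])
    show "norm (complex_of_real (f \<xi>) - complex_of_real (g \<xi>)) < e" if "\<xi> \<in> torus" for \<xi>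
      unfolding of_real_diff[symmetric] norm_of_real using g(2) that by blast
  qed
qed

text \<open>The indicator of K is a bounded pointwise limit of the distance bumps
  \<open>f n\<close>, and each bump is replaced by a trigonometric polynomial within
  \<open>1 / (n + 1)\<close>, on which L vanishes.\<close>

lemma sigma_functional_eq_0_closed:
  fixes L :: "(complex ^ 'n::finite \<Rightarrow> complex) \<Rightarrow> complex"
  assumes L: "sigma_functional torus_borel L" and zero: "\<And>k. L (torus_char k) = 0"
    and K: "closed K"
  shows "L (indicator K) = 0"
proof -
  have poly: "L f = 0" if "f \<in> trig_poly" for f
    using that
  proof (induction rule: trig_poly.induct)
    case (cong f g)
    have "L g = L f"
      using cong.hyps by (intro sigma_functional_cong[OF L] trig_poly_bounded_measurable) auto
    then show ?case using cong.IH by simp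
  qed (auto simp: zero sigma_functional_add[OF L] sigma_functional_scale[OF L]
      trig_poly_bounded_measurable)
  show ?thesis
  \<comment> \<open>The empty set is separated because \<open>infdist\<close> to it is 0 by
    convention, so the bumps below would be constantly 1.\<close>
  proof (cases "K = {}")
    case True
    have "indicator K = (\<lambda>\<xi>. 0 :: complex)" using True by auto
    then show ?thesis using poly[OF trig_poly_const[of 0]] by simp
  next
    case False
    define f where "f n \<xi> = max 0 (1 - real n * infdist \<xi> K)" for n \<xi>
    have "\<exists>g. g \<in> trig_poly \<and> (\<forall>\<xi>\<in>torus. norm (complex_of_real (f n \<xi>) - g \<xi>) < inverse (real (Suc n)))" for n
    proof -
      have "continuous_on torus (f n)"
        unfolding f_def by (intro continuous_intros)
      moreover have "inverse (real (Suc n)) > 0" by simp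
      ultimately show ?thesis
        using trig_poly_dense by metis
    qed
    then obtain g where g: "\<And>n. g n \<in> trig_poly"
      "\<And>n \<xi>. \<xi> \<in> torus \<Longrightarrow> norm (complex_of_real (f n \<xi>) - g n \<xi>) < inverse (real (Suc n))"
      by metis
    have "(\<lambda>n. L (g n)) \<longlonglongrightarrow> L (indicator K)"
    proof (rule sigma_functional_lim[OF L])
      show "g n \<in> borel_measurable torus_borel" for n
        by (intro bounded_measurable_measurable trig_poly_bounded_measurable g)
      fix \<xi> :: "complex ^ 'n" assume "\<xi> \<in> space torus_borel"
      then have \<xi>: "\<xi> \<in> torus" by simp
      \<comment> \<open>The bump contributes at most 1 and the approximation error less than
        1.\<close>
      show "norm (g n \<xi>) \<le> 2" for n
      proof -
        have "norm (complex_of_real (f n \<xi>)) \<le> 1"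
          by (simp add: f_def infdist_nonneg)
        moreover have "norm (complex_of_real (f n \<xi>) - g n \<xi>) < 1"
          using g(2)[OF \<xi>, of n] inverse_le_1_iff[of "real (Suc n)"] by linarith
        ultimately show ?thesis
          using norm_triangle_ineq4[of "complex_of_real (f n \<xi>)" "complex_of_real (f n \<xi>) - g n \<xi>"]
          by simp
      qed
      have f: "(\<lambda>n. f n \<xi>) \<longlonglongrightarrow> indicator K \<xi>"
      proof (cases "\<xi> \<in> K")
        case True
        then show ?thesis by (simp add: f_def)
      next
        case False
        then have "infdist \<xi> K > 0"
          using K \<open>K \<noteq> {}\<close> by (simp add: infdist_pos_not_in_closed)
        then obtain N where N: "1 < real N * infdist \<xi> K"
          using reals_Archimedean3 by blast
        have "f n \<xi> = 0" if "n \<ge> N" for n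
        proof -
          have "real N * infdist \<xi> K \<le> real n * infdist \<xi> K"
            using that by (intro mult_right_mono) (auto simp: infdist_nonneg)
          then show ?thesis using N by (simp add: f_def)
        qed
        then have "eventually (\<lambda>n. f n \<xi> = indicator K \<xi>) sequentially"
          using False by (auto simp: eventually_sequentially)
        then show ?thesis by (rule tendsto_eventually)
      qed
      have "(\<lambda>n. complex_of_real (f n \<xi>) - g n \<xi>) \<longlonglongrightarrow> 0"
        using g(2)[OF \<xi>] less_imp_le
        by (intro Lim_null_comparison[OF _ LIMSEQ_inverse_real_of_nat]) (auto intro!: always_eventually)
      from tendsto_diff[OF tendsto_of_real[OF f] this]
      have "(\<lambda>n. g n \<xi>) \<longlonglongrightarrow> complex_of_real (indicator K \<xi>)"
        by simp
      moreover have "complex_of_real (indicator K \<xi>) = indicator K \<xi>"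
        by (simp add: indicator_def)
      ultimately show "(\<lambda>n. g n \<xi>) \<longlonglongrightarrow> indicator K \<xi>"
        by simp
    qed
    then show ?thesis
      by (simp add: poly[OF g(1)] LIMSEQ_const_iff)
  qed
qed

text \<open>A Dynkin argument over the intersection-stable generator of closed sets, run on the
  Borel sets of the whole vector space. Complements use that the whole space is closed; disjoint
  unions use bounded convergence, the partial sums being indicators. Only the last step intersects
  with the torus.\<close>

lemma sigma_functional_Fourier_unique:
  fixes L :: "(complex ^ 'n::finite \<Rightarrow> complex) \<Rightarrow> complex"
  assumes L: "sigma_functional torus_borel L" and zero: "\<And>k. L (torus_char k) = 0"
    and A: "A \<in> sets torus_borel"
  shows "L (indicator A) = 0"
proof -
  have bm: "indicator B \<in> bounded_measurable (torus_borel :: (complex ^ 'n) measure)" if "B \<in> sets borel" for B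
    using that by (intro bounded_measurableI[of _ _ 1])
      (auto simp: torus_borel_def indicator_def intro: measurable_restrict_space1)
  have stable: "Int_stable (Collect closed :: (complex ^ 'n) set set)"
    by (auto simp: Int_stable_def)
  have closed_Pow: "Collect closed \<subseteq> Pow (UNIV :: (complex ^ 'n) set)"
    by simp
  have "L (indicator B) = 0" if "B \<in> sigma_sets UNIV (Collect closed)" for B
    using stable closed_Pow that
  proof (induction rule: sigma_sets_induct_disjoint)
    case (basic K)
    then show ?case by (intro sigma_functional_eq_0_closed[OF L zero]) auto
  next
    case empty
    show ?case by (intro sigma_functional_eq_0_closed[OF L zero]) auto
  next
    case (compl B)
    then have B: "B \<in> sets borel" by (simp add: borel_eq_closed)
    have "L (indicator UNIV) = L (\<lambda>\<xi>. indicator B \<xi> + indicator (UNIV - B) \<xi>)"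
      by (rule arg_cong[of _ _ L]) (auto simp: indicator_def)
    also have "\<dots> = L (indicator B) + L (indicator (UNIV - B))"
      using B by (intro sigma_functional_add[OF L] bm) auto
    finally show ?case
      using compl.IH sigma_functional_eq_0_closed[OF L zero, of UNIV] by simp
  next
    case (union B)
    have B: "B i \<in> sets borel" for i
      using union.hyps(2) by (auto simp: borel_eq_closed)
    have "(\<lambda>n. L (\<lambda>\<xi>. \<Sum>i<n. indicator (B i) \<xi>)) \<longlonglongrightarrow> L (indicator (\<Union>i. B i))"
    proof (rule sigma_functional_lim[OF L])
      have partial: "(\<Sum>i<n. indicator (B i) \<xi>) = (indicator (\<Union>i<n. B i) \<xi> :: complex)" for n \<xi>
      proof -
        have "disjoint_family_on B {..<n}"
          using union.hyps(1) by (rule disjoint_family_on_mono[OF subset_UNIV])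
        then have "(indicator (\<Union>i<n. B i) \<xi> :: complex) = (\<Sum>i<n. indicator (B i) \<xi>)"
          by (intro indicator_UN_disjoint finite_lessThan)
        then show ?thesis by (rule sym)
      qed
      show "(\<lambda>\<xi>. \<Sum>i<n. indicator (B i) \<xi> :: complex) \<in> borel_measurable torus_borel" for n
        by (intro bounded_measurable_measurable bounded_measurable_sum bm B)
      fix \<xi> :: "complex ^ 'n"
      show "norm (\<Sum>i<n. indicator (B i) \<xi> :: complex) \<le> 1" for n
        unfolding partial by (simp add: indicator_def)
      show "(\<lambda>n. \<Sum>i<n. indicator (B i) \<xi>) \<longlonglongrightarrow> (indicator (\<Union>i. B i) \<xi> :: complex)"
        unfolding partial by (rule LIMSEQ_indicator_UN)
    qed
    moreover have "L (\<lambda>\<xi>. \<Sum>i<n. indicator (B i) \<xi>) = 0" for n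
      by (subst sigma_functional_sum[OF L]) (auto intro!: sum.neutral bm B union.IH)
    ultimately show ?case
      by (simp add: LIMSEQ_const_iff)
  qed
  moreover obtain B where "B \<in> sets borel" "A = torus \<inter> B"
    using A by (auto simp: torus_borel_def sets_restrict_space)
  ultimately have "L (indicator B) = 0"
    by (simp add: borel_eq_closed)
  moreover have "L (indicator A) = L (indicator B)"
    using \<open>A = torus \<inter> B\<close>
    by (intro sigma_functional_cong[OF L] bm \<open>B \<in> sets borel\<close>) (auto simp: indicator_def)
  ultimately show ?thesis by simp
qed

section \<open>Lebesgue measure on the circle\<close>

lemma space_circle_borel [simp]: "space circle_borel = {z. cmod z = 1}"
  by (simp add: circle_borel_def space_restrict_space)

lemma measurable_circle_borel: "f \<in> borel_measurable borel \<Longrightarrow> f \<in> borel_measurable circle_borel"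
  unfolding circle_borel_def by (rule measurable_restrict_space1)

lemma measurable_cis: "(\<lambda>t. cis (2 * pi * t)) \<in> measurable borel circle_borel"
  unfolding circle_borel_def
  by (intro measurable_restrict_space2 borel_measurable_continuous_onI continuous_intros) auto

lemma measurable_cis_uniform:
  "(\<lambda>t. cis (2 * pi * t)) \<in> measurable (uniform_measure lborel {0..1}) circle_borel"
  using measurable_cis by simp

lemma sets_circle_lebesgue [simp, measurable_cong]: "sets circle_lebesgue = sets circle_borel"
  by (simp add: circle_lebesgue_def)

lemma space_circle_lebesgue [simp]: "space circle_lebesgue = {z. cmod z = 1}"
  by (simp add: circle_lebesgue_def)

lemma prob_space_circle_lebesgue: "prob_space circle_lebesgue"
  unfolding circle_lebesgue_def
  by (intro prob_space.prob_space_distr prob_space_uniform_measure measurable_cis_uniform) auto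

text \<open>For nonzero s the integrand \<open>cis (a * t)\<close> has an antiderivative of period
  1, which takes equal values at both ends of the unit interval.\<close>

lemma integral_circle_lebesgue_powi:
  "(\<integral>z. cnj z powi s \<partial>circle_lebesgue) = (if s = 0 then 1 else 0)"
proof -
  let ?c = "\<lambda>t. cis (- of_int s * (2 * pi * t))"
  have "(\<integral>z. cnj z powi s \<partial>circle_lebesgue) =
      (\<integral>t. cnj (cis (2 * pi * t)) powi s \<partial>uniform_measure lborel {0..1})"
    unfolding circle_lebesgue_def
    by (intro integral_distr measurable_cis_uniform measurable_circle_borel borel_measurable_powi
        borel_measurable_continuous_onI continuous_intros)
  also have "\<dots> = (\<integral>t. ?c t \<partial>uniform_measure lborel {0..1})"
    by (simp add: cis_cnj cis_power_int)
  also have "\<dots> = (\<integral>t. indicator {0..1} t *\<^sub>R ?c t \<partial>lborel)"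
  proof -
    have "uniform_measure lborel {0..1::real} = density lborel (\<lambda>t. ennreal (indicator {0..1} t))"
      unfolding uniform_measure_def by (simp add: ennreal_indicator divide_ennreal_def)
    then show ?thesis
      by (simp only:) (rule integral_density,
        auto intro!: borel_measurable_continuous_onI continuous_intros)
  qed
  also have "\<dots> = (if s = 0 then 1 else 0)"
  proof (cases "s = 0")
    case False
    define a where "a = - of_int s * (2 * pi)"
    have a: "a \<noteq> 0" using False by (simp add: a_def)
    have "((\<lambda>t. exp (\<i> * a * of_real t) / (\<i> * a)) has_vector_derivative exp (\<i> * a * of_real t))
        (at t within {0..1})" for t
      using a by (intro has_vector_derivative_real_field)
        (auto intro!: derivative_eq_intros)
    then have "((\<lambda>t. cis (a * t) / (\<i> * a)) has_vector_derivative cis (a * t)) (at t within {0..1})" for t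
      by (simp add: cis_conv_exp mult.assoc)
    then have "(\<integral>t. indicator {0..1} t *\<^sub>R cis (a * t) \<partial>lborel)
        = cis (a * 1) / (\<i> * a) - cis (a * 0) / (\<i> * a)"
      by (intro integral_FTC_Icc continuous_intros) auto
    moreover have "cis a = 1"
      using cis_multiple_2pi[of "- of_int s"] by (simp add: a_def mult_ac)
    ultimately show ?thesis
      using False by (simp add: a_def mult.assoc)
  qed simp
  finally show ?thesis .
qed

text \<open>Jordan's inequality: sine is concave on this interval, so it lies above the chord from
  (0, 0) to (pi/2, 1).\<close>

lemma sin_ge_chord:
  assumes "0 \<le> x" "x \<le> pi / 2"
  shows "2 * x / pi \<le> sin x"
proof -
  have "convex_on {0..pi/2} (\<lambda>x. - sin x)"
  proof (rule f''_ge0_imp_convex)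
    show "((\<lambda>x. - sin x) has_real_derivative - cos x) (at x)" for x :: real
      by (auto intro!: derivative_eq_intros)
    show "((\<lambda>x. - cos x) has_real_derivative sin x) (at x)" for x :: real
      by (auto intro!: derivative_eq_intros)
    show "0 \<le> sin x" if "x \<in> {0..pi/2}" for x :: real
      using that by (intro sin_ge_zero) auto
  qed auto
  from convex_onD_Icc'[OF this, of x] assms show ?thesis
    by simp
qed

text \<open>The minimum is the distance of the parameters around a circle of circumference 1. The
  corresponding arc is 2 pi times as long, and by Jordan's inequality a chord is at least 2/pi times
  its arc, whence the factor 4.\<close>

lemma norm_cis_diff_ge:
  assumes "0 \<le> s" "s \<le> 1" "0 \<le> t" "t \<le> 1"
  shows "4 * min \<bar>t - s\<bar> (1 - \<bar>t - s\<bar>) \<le> norm (cis (2 * pi * t) - cis (2 * pi * s))"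
proof -
  define u where "u = \<bar>t - s\<bar>"
  have u: "0 \<le> u" "u \<le> 1" using assms by (auto simp: u_def)
  have sin: "2 * min u (1 - u) \<le> sin (pi * u)"
  proof (cases "u \<le> 1/2")
    case True
    then show ?thesis using sin_ge_chord[of "pi * u"] u by simp
  next
    case False
    have "sin (pi * u) = sin (pi * (1 - u))"
      by (simp add: right_diff_distrib)
    then show ?thesis using sin_ge_chord[of "pi * (1 - u)"] u False by simp
  qed
  have "cis (2 * pi * t) - cis (2 * pi * s) = cis (2 * pi * s) * (cis (2 * pi * (t - s)) - 1)"
    by (simp add: right_diff_distrib cis_mult)
  then have "norm (cis (2 * pi * t) - cis (2 * pi * s)) = norm (exp (\<i> * of_real (2 * pi * (t - s))) - 1)"
    by (simp add: norm_mult cis_conv_exp)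
  also have "\<dots> = 2 * \<bar>sin (pi * (t - s))\<bar>"
    by (subst dist_exp_i_1) simp
  also have "\<bar>sin (pi * (t - s))\<bar> = \<bar>sin (pi * u)\<bar>"
  proof (cases "t \<ge> s")
    case False
    then have "pi * u = - (pi * (t - s))" by (simp add: u_def algebra_simps)
    then show ?thesis by (metis sin_minus abs_minus_cancel)
  qed (simp add: u_def)
  finally show ?thesis
    using sin abs_ge_self[of "sin (pi * u)"] unfolding u_def by linarith
qed

lemma emeasure_circle_lebesgue_arc:
  assumes c: "norm c = 1" and r: "r > 0"
  shows "emeasure circle_lebesgue {z \<in> space circle_borel. norm (z - c) < r} \<le> ennreal r"
proof -
  obtain a where a: "0 \<le> a" "a < 2 * pi" "c = Complex (cos a) (sin a)"
    using complex_unimodular_polar[OF c] by auto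
  define s where "s = a / (2 * pi)"
  have s: "0 \<le> s" "s \<le> 1" "c = cis (2 * pi * s)"
    using a by (auto simp: s_def cis.code field_simps)
  have meas: "{z \<in> space circle_borel. norm (z - c) < r} \<in> sets circle_borel"
  proof -
    have [measurable]: "(\<lambda>z. norm (z - c)) \<in> borel_measurable circle_borel"
      by (intro measurable_circle_borel borel_measurable_continuous_onI continuous_intros)
    show ?thesis by measurable
  qed
  let ?I = "\<lambda>t. {t - r/4..t + r/4}"
  have "emeasure circle_lebesgue {z \<in> space circle_borel. norm (z - c) < r}
      = emeasure (uniform_measure lborel {0..1}) {t. norm (cis (2 * pi * t) - c) < r}"
    unfolding circle_lebesgue_def
    by (subst emeasure_distr[OF measurable_cis_uniform meas]) (auto intro!: arg_cong2[where f = emeasure])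
  also have "\<dots> = emeasure lborel ({0..1} \<inter> {t. norm (cis (2 * pi * t) - c) < r})"
    by (subst emeasure_uniform_measure)
      (auto intro!: borel_open open_Collect_less continuous_intros simp: divide_ennreal_def)
  \<comment> \<open>Either t is within r/4 of s directly, or it is so across the point where 0 and 1
    are glued, which puts it within r/4 of 0 or of 1. The three intervals have lengths r/2, r/4 and
    r/4, summing to r.\<close>
  also have "\<dots> \<le> emeasure lborel ({s - r/4..s + r/4} \<union> {0..r/4} \<union> {1 - r/4..1})"
  proof (intro emeasure_mono subsetI)
    fix t assume t: "t \<in> {0..1} \<inter> {t. norm (cis (2 * pi * t) - c) < r}"
    then have "4 * min \<bar>t - s\<bar> (1 - \<bar>t - s\<bar>) < r"
      using norm_cis_diff_ge[OF s(1,2), of t] by (auto simp: s(3))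
    then show "t \<in> {s - r/4..s + r/4} \<union> {0..r/4} \<union> {1 - r/4..1}"
      using t s(1,2) by (auto simp: min_def abs_if split: if_splits)
  qed auto
  also have "\<dots> \<le> emeasure lborel {s - r/4..s + r/4} + emeasure lborel {0..r/4} + emeasure lborel {1 - r/4..1}"
    by (intro order_trans[OF emeasure_subadditive] add_mono) auto
  also have "\<dots> = ennreal r"
    using r by (simp flip: ennreal_plus)
  finally show ?thesis .
qed

section \<open>Product measures and the diagonal action\<close>

lemma borel_measurable_vec:
  fixes f :: "'a \<Rightarrow> complex ^ 'n::finite"
  assumes "\<And>i. (\<lambda>x. f x $ i) \<in> borel_measurable M"
  shows "f \<in> borel_measurable M"
proof (rule borel_measurable_euclidean_space[THEN iffD2], rule ballI)
  fix b :: "complex ^ 'n" assume "b \<in> Basis"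
  then obtain i u where "b = axis i u"
    by (auto simp: Basis_vec_def)
  then show "(\<lambda>x. f x \<bullet> b) \<in> borel_measurable M"
    by (simp only: inner_axis) (intro borel_measurable_inner assms borel_measurable_const)
qed

lemma measurable_torus_borelI:
  fixes f :: "'a \<Rightarrow> complex ^ 'n::finite"
  assumes "\<And>i. (\<lambda>x. f x $ i) \<in> borel_measurable M" "\<And>x i. x \<in> space M \<Longrightarrow> norm (f x $ i) = 1"
  shows "f \<in> measurable M torus_borel"
  unfolding torus_borel_def
  by (intro measurable_restrict_space2 borel_measurable_vec assms(1)) (auto simp: torus_def assms(2))

text \<open>Common form of Haar measure and of \<open>dirac_lebesgue\<close>, so that measurability
  and Fourier coefficients are settled for both at once.\<close>

definition torus_prod :: "('n::finite \<Rightarrow> complex measure) \<Rightarrow> (complex ^ 'n) measure" where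
  "torus_prod N = distr (PiM UNIV N) torus_borel vec_lambda"

lemma sets_torus_prod [simp]: "sets (torus_prod N) = sets torus_borel"
  by (simp add: torus_prod_def)

context
  fixes N :: "'n::finite \<Rightarrow> complex measure"
  assumes prob: "\<And>i. prob_space (N i)" and sets_N: "\<And>i. sets (N i) = sets circle_borel"
begin

lemma space_N: "space (N i) = {z. cmod z = 1}"
  using sets_eq_imp_space_eq[OF sets_N[of i]] by simp

lemma measurable_N: "f \<in> borel_measurable borel \<Longrightarrow> f \<in> borel_measurable (N i)"
  by (subst measurable_cong_sets[OF sets_N refl]) (rule measurable_circle_borel)

lemma measurable_component_N: "(\<lambda>x. x i) \<in> borel_measurable (PiM UNIV N)"
proof -
  have "(\<lambda>z. z) \<in> borel_measurable (N i)"
    by (intro measurable_N borel_measurable_continuous_onI continuous_on_id)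
  then show ?thesis
    by (rule measurable_compose[OF measurable_component_singleton[OF UNIV_I]])
qed

lemma measurable_vec_lambda: "vec_lambda \<in> measurable (PiM UNIV N) torus_borel"
  by (rule measurable_torus_borelI) (auto simp: measurable_component_N space_PiM space_N PiE_iff)

lemma prob_space_torus_prod: "prob_space (torus_prod N)"
  unfolding torus_prod_def
  by (intro prob_space.prob_space_distr prob_space_PiM prob measurable_vec_lambda)

lemma finite_measure_torus_prod: "finite_measure (torus_prod N)"
  using prob_space_torus_prod by (rule prob_space.finite_measure)

lemma integral_torus_char_torus_prod:
  "(\<integral>\<xi>. torus_char k \<xi> \<partial>torus_prod N) = (\<Prod>i\<in>UNIV. \<integral>z. cnj z powi (k $ i) \<partial>N i)"
proof -
  interpret product_sigma_finite N
    by (intro product_sigma_finite.intro prob_space_imp_sigma_finite prob)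
  have "(\<integral>\<xi>. torus_char k \<xi> \<partial>torus_prod N) = (\<integral>x. torus_char k (vec_lambda x) \<partial>PiM UNIV N)"
    unfolding torus_prod_def by (intro integral_distr measurable_vec_lambda measurable_torus_char)
  also have "\<dots> = (\<integral>x. (\<Prod>i\<in>UNIV. cnj (x i) powi (k $ i)) \<partial>PiM UNIV N)"
    by (simp add: torus_char_def)
  also have "\<dots> = (\<Prod>i\<in>UNIV. \<integral>z. cnj z powi (k $ i) \<partial>N i)"
  proof (rule product_integral_prod)
    fix i :: 'n
    interpret finite_measure "N i"
      using prob by (rule prob_space.finite_measure)
    show "integrable (N i) (\<lambda>z. cnj z powi (k $ i))"
      by (rule integrable_const_bound[of _ 1])
        (auto simp: space_N norm_power_int intro!: measurable_N borel_measurable_powi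
          borel_measurable_continuous_onI continuous_intros)
  qed simp
  finally show ?thesis .
qed

end

section \<open>Haar measure and tubes around diagonal orbits\<close>

definition haar :: "(complex ^ 'n::finite) measure" where
  "haar = torus_prod (\<lambda>_. circle_lebesgue)"

lemma sets_haar [simp, measurable_cong]: "sets haar = sets torus_borel"
  by (simp add: haar_def)

lemma prob_space_haar: "prob_space haar"
  unfolding haar_def by (intro prob_space_torus_prod prob_space_circle_lebesgue sets_circle_lebesgue)

lemma integral_torus_char_haar:
  "(\<integral>\<xi>. torus_char k \<xi> \<partial>haar) = (if k = 0 then 1 else 0)"
proof -
  have "(\<integral>\<xi>. torus_char k \<xi> \<partial>haar) = (\<Prod>i\<in>UNIV. if k $ i = 0 then 1 else 0)"
    unfolding haar_def
    by (subst integral_torus_char_torus_prod)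
      (auto simp: prob_space_circle_lebesgue integral_circle_lebesgue_powi)
  also have "\<dots> = (if k = 0 then 1 else 0)"
    by (auto simp: vec_eq_iff)
  finally show ?thesis .
qed

text \<open>A neighbourhood of the diagonal orbit of c: on the torus, multiplying by a conjugate is
  division, and the quotients \<xi>_i / \<xi>_j are constant along orbits. For c on the torus the
  condition at \<open>i = j\<close> reads \<open>0 < r\<close>, which leaves n-1 genuine
  constraints.\<close>

definition diagonal_tube :: "'n \<Rightarrow> complex ^ 'n \<Rightarrow> real \<Rightarrow> (complex ^ 'n) set" where
  "diagonal_tube j c r = {\<xi> \<in> torus. \<forall>i. norm (\<xi> $ i * cnj (\<xi> $ j) - c $ i * cnj (c $ j)) < r}"

lemma diagonal_tube_sets: "diagonal_tube j c r \<in> sets (torus_borel :: (complex ^ 'n::finite) measure)"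
proof -
  let ?U = "{\<xi> :: complex ^ 'n. \<forall>i. norm (\<xi> $ i * cnj (\<xi> $ j) - c $ i * cnj (c $ j)) < r}"
  have "open ?U"
    unfolding Collect_all_eq
    by (intro open_INT ballI open_Collect_less continuous_intros finite)
  moreover have "diagonal_tube j c r = torus \<inter> ?U"
    by (auto simp: diagonal_tube_def)
  ultimately show ?thesis
    unfolding torus_borel_def sets_restrict_space by (intro image_eqI[of _ _ ?U]) auto
qed

text \<open>Fubini with the reference coordinate y integrated last. For fixed y, multiplication by
  the unimodular y turns each quotient condition into membership of coordinate i in an arc of radius
  r; each of the n-1 arcs has measure at most r.\<close>

lemma emeasure_haar_diagonal_tube:
  fixes c :: "complex ^ 'n::finite"
  assumes c: "c \<in> torus" and r: "r > 0"
  shows "emeasure haar (diagonal_tube j c r) \<le> ennreal (r ^ (CARD('n) - 1))"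
proof -
  let ?N = "\<lambda>_::'n. circle_lebesgue"
  let ?W = "diagonal_tube j c r"
  let ?I = "UNIV - {j}"
  interpret product_sigma_finite ?N
    by (intro product_sigma_finite.intro prob_space_imp_sigma_finite prob_space_circle_lebesgue)
  interpret P: prob_space circle_lebesgue by (rule prob_space_circle_lebesgue)
  have vl: "vec_lambda \<in> measurable (PiM UNIV ?N) torus_borel"
    by (intro measurable_vec_lambda prob_space_circle_lebesgue sets_circle_lebesgue)
  have ind: "(\<lambda>x. indicator ?W (vec_lambda x) :: ennreal) \<in> borel_measurable (PiM (insert j ?I) ?N)"
    using measurable_compose[OF vl borel_measurable_indicator[OF diagonal_tube_sets]]
    by (simp add: insert_Diff_if)
  have "emeasure haar ?W = (\<integral>\<^sup>+\<xi>. indicator ?W \<xi> \<partial>haar)"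
    by (simp add: diagonal_tube_sets)
  also have "\<dots> = (\<integral>\<^sup>+x. indicator ?W (vec_lambda x) \<partial>PiM UNIV ?N)"
    unfolding haar_def torus_prod_def
    by (intro nn_integral_distr vl borel_measurable_indicator) (simp add: diagonal_tube_sets)
  also have "\<dots> = (\<integral>\<^sup>+x. indicator ?W (vec_lambda x) \<partial>PiM (insert j ?I) ?N)"
    by (simp add: insert_Diff_if)
  also have "\<dots> = (\<integral>\<^sup>+y. (\<integral>\<^sup>+x. indicator ?W (vec_lambda (x(j := y))) \<partial>PiM ?I ?N) \<partial>circle_lebesgue)"
    by (intro product_nn_integral_insert_rev ind) auto
  also have "\<dots> \<le> (\<integral>\<^sup>+y. ennreal (r ^ (CARD('n) - 1)) \<partial>circle_lebesgue)"
  proof (rule nn_integral_mono)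
    fix y assume "y \<in> space circle_lebesgue"
    then have y: "cmod y = 1" by simp
    define A where "A i = {z \<in> space circle_borel. norm (z - c $ i * cnj (c $ j) * y) < r}" for i
    have A: "A i \<in> sets circle_lebesgue" for i
    proof -
      have [measurable]: "(\<lambda>z. norm (z - c $ i * cnj (c $ j) * y)) \<in> borel_measurable circle_borel"
        by (intro measurable_circle_borel borel_measurable_continuous_onI continuous_intros)
      show ?thesis unfolding A_def sets_circle_lebesgue by measurable
    qed
    have yy: "y * cnj y = 1"
      using y by (simp add: complex_norm_square[symmetric])
    have sub: "x \<in> PiE ?I A" if x: "x \<in> space (PiM ?I ?N)" "vec_lambda (x(j := y)) \<in> ?W" for x
    proof -
      have "x i \<in> A i" if "i \<noteq> j" for i
      proof -
        have "norm (x i * cnj y - c $ i * cnj (c $ j)) < r"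
          using x(2) that by (auto simp: diagonal_tube_def dest!: spec[of _ i])
        moreover have "x i - c $ i * cnj (c $ j) * y = (x i * cnj y - c $ i * cnj (c $ j)) * y"
        proof -
          have "(x i * cnj y - c $ i * cnj (c $ j)) * y = x i * (y * cnj y) - c $ i * cnj (c $ j) * y"
            by (simp add: algebra_simps)
          then show ?thesis by (simp only: yy mult_1_right)
        qed
        ultimately have "norm (x i - c $ i * cnj (c $ j) * y) < r"
          using y by (simp add: norm_mult)
        then show ?thesis
          using x(1) that by (auto simp: A_def space_PiM PiE_iff)
      qed
      then show ?thesis using x(1) by (auto simp: space_PiM PiE_iff)
    qed
    have "(\<integral>\<^sup>+x. indicator ?W (vec_lambda (x(j := y))) \<partial>PiM ?I ?N) \<le> (\<integral>\<^sup>+x. indicator (PiE ?I A) x \<partial>PiM ?I ?N)"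
      using sub by (intro nn_integral_mono) (auto simp: indicator_def)
    also have "\<dots> = (\<Prod>i\<in>?I. emeasure circle_lebesgue (A i))"
      using A by (subst nn_integral_indicator) (auto intro!: emeasure_PiM sets_PiM_I_finite)
    also have "\<dots> \<le> (\<Prod>i\<in>?I. ennreal r)"
    proof (intro prod_mono_ennreal)
      fix i
      have "norm (c $ i * cnj (c $ j) * y) = 1"
        using c y by (simp add: norm_mult torus_norm_nth)
      then show "emeasure circle_lebesgue (A i) \<le> ennreal r"
        unfolding A_def using r by (rule emeasure_circle_lebesgue_arc)
    qed
    also have "\<dots> = ennreal (r ^ (CARD('n) - 1))"
      using r by (simp add: ennreal_power card_Diff_singleton)
    finally show "(\<integral>\<^sup>+x. indicator ?W (vec_lambda (x(j := y))) \<partial>PiM ?I ?N) \<le> ennreal (r ^ (CARD('n) - 1))" .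
  qed
  also have "\<dots> = ennreal (r ^ (CARD('n) - 1))"
    by (simp add: P.emeasure_space_1[simplified])
  finally show ?thesis .
qed

text \<open>Averaging over the diagonal circle, i.e. the adjoint of convolution with its Haar measure.\<close>

definition diagonal_average :: "(complex ^ 'n \<Rightarrow> complex) \<Rightarrow> complex ^ 'n \<Rightarrow> complex" where
  "diagonal_average f \<xi> = (\<integral>w. f (w *s \<xi>) \<partial>circle_lebesgue)"

lemma measurable_diagonal_action:
  "(\<lambda>p. snd p *s fst p) \<in> measurable (torus_borel \<Otimes>\<^sub>M circle_lebesgue) (torus_borel :: (complex ^ 'n::finite) measure)"
proof (rule measurable_torus_borelI)
  have [measurable]: "(\<lambda>z. z) \<in> borel_measurable circle_borel"
    by (intro measurable_circle_borel borel_measurable_continuous_onI continuous_on_id)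
  show "(\<lambda>p. (snd p *s fst p) $ i) \<in> borel_measurable (torus_borel \<Otimes>\<^sub>M circle_lebesgue)" for i :: 'n
    unfolding vector_smult_component by measurable
qed (auto simp: space_pair_measure norm_mult torus_norm_nth)

lemma measurable_diagonal_action_left:
  assumes "\<xi> \<in> torus"
  shows "(\<lambda>w. w *s \<xi>) \<in> measurable circle_lebesgue torus_borel"
proof -
  have "Pair \<xi> \<in> measurable circle_lebesgue (torus_borel \<Otimes>\<^sub>M circle_lebesgue)"
    using assms by (intro measurable_Pair1') simp
  from measurable_compose[OF this measurable_diagonal_action] show ?thesis by simp
qed

lemma borel_measurable_diagonal_average:
  assumes "f \<in> borel_measurable (torus_borel :: (complex ^ 'n::finite) measure)"
  shows "diagonal_average f \<in> borel_measurable torus_borel"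
proof -
  interpret prob_space circle_lebesgue by (rule prob_space_circle_lebesgue)
  have "(\<lambda>(\<xi>, w). f (w *s \<xi>)) \<in> borel_measurable (torus_borel \<Otimes>\<^sub>M circle_lebesgue)"
    using measurable_compose[OF measurable_diagonal_action assms] by (simp add: case_prod_beta')
  then show ?thesis
    unfolding diagonal_average_def[abs_def] by (rule borel_measurable_lebesgue_integral)
qed

lemma norm_diagonal_average_le:
  assumes "\<And>\<eta>. \<eta> \<in> torus \<Longrightarrow> norm (f \<eta>) \<le> C" "\<xi> \<in> torus"
  shows "norm (diagonal_average f \<xi>) \<le> C"
proof -
  interpret prob_space circle_lebesgue by (rule prob_space_circle_lebesgue)
  have act: "w *s \<xi> \<in> torus" if "cmod w = 1" for w
    using assms(2) that by (simp add: torus_def norm_mult)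
  have "0 \<le> C"
    using norm_ge_zero order_trans assms by blast
  show ?thesis
  proof (cases "integrable circle_lebesgue (\<lambda>w. f (w *s \<xi>))")
    case True
    then have "norm (diagonal_average f \<xi>) \<le> (\<integral>w. norm (f (w *s \<xi>)) \<partial>circle_lebesgue)"
      unfolding diagonal_average_def by (intro integral_norm_bound)
    also have "\<dots> \<le> (\<integral>w. C \<partial>circle_lebesgue)"
      using True by (intro integral_mono integrable_norm integrable_const) (auto intro!: assms(1) act)
    finally show ?thesis by (simp add: prob_space[simplified])
  next
    \<comment> \<open>The integral of a non-integrable function is 0 by default, so the bound
      persists.\<close>
    case False
    then show ?thesis using \<open>0 \<le> C\<close> by (simp add: diagonal_average_def not_integrable_integral_eq)
  qed
qed

lemma bounded_measurable_diagonal_average: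
  assumes "f \<in> bounded_measurable torus_borel"
  shows "diagonal_average f \<in> bounded_measurable torus_borel"
proof -
  obtain C where "f \<in> borel_measurable torus_borel" "0 \<le> C" "\<And>x. x \<in> space torus_borel \<Longrightarrow> norm (f x) \<le> C"
    using assms by (rule bounded_measurableE) (rule that)
  then show ?thesis
    by (intro bounded_measurableI[of _ _ C] borel_measurable_diagonal_average norm_diagonal_average_le) auto
qed

lemma integrable_diagonal_action:
  assumes "f \<in> bounded_measurable torus_borel" "\<xi> \<in> torus"
  shows "integrable circle_lebesgue (\<lambda>w. f (w *s \<xi>))"
proof -
  obtain C where C: "f \<in> borel_measurable torus_borel" "0 \<le> C" "\<And>x. x \<in> space torus_borel \<Longrightarrow> norm (f x) \<le> C"
    using assms(1) by (rule bounded_measurableE) (rule that)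
  interpret prob_space circle_lebesgue by (rule prob_space_circle_lebesgue)
  have "(\<lambda>w. f (w *s \<xi>)) \<in> borel_measurable circle_lebesgue"
    using measurable_compose[OF measurable_diagonal_action_left[OF assms(2)] C(1)] .
  moreover have "w *s \<xi> \<in> torus" if "cmod w = 1" for w
    using assms(2) that by (simp add: torus_def norm_mult)
  ultimately show ?thesis
    using C(3) by (intro integrable_const_bound[of _ C]) auto
qed

text \<open>This functional represents the convolution of the underlying measure with Haar measure
  on the diagonal circle. Bounded convergence passes first through the circle integral and then
  through L.\<close>

lemma sigma_functional_diagonal_average:
  assumes L: "sigma_functional torus_borel L"
  shows "sigma_functional torus_borel (\<lambda>f. L (diagonal_average f))"
proof (rule sigma_functionalI)
  fix f g :: "complex ^ 'a \<Rightarrow> complex"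
  assume fg: "f \<in> bounded_measurable torus_borel" "g \<in> bounded_measurable torus_borel"
  have "L (diagonal_average (\<lambda>x. f x + g x)) = L (\<lambda>\<xi>. diagonal_average f \<xi> + diagonal_average g \<xi>)"
    using fg by (intro sigma_functional_cong[OF L] bounded_measurable_add bounded_measurable_diagonal_average)
      (auto simp: diagonal_average_def integrable_diagonal_action)
  also have "\<dots> = L (diagonal_average f) + L (diagonal_average g)"
    using fg by (intro sigma_functional_add[OF L] bounded_measurable_diagonal_average)
  finally show "L (diagonal_average (\<lambda>x. f x + g x)) = L (diagonal_average f) + L (diagonal_average g)" .
next
  fix f :: "complex ^ 'a \<Rightarrow> complex" and c
  assume f: "f \<in> bounded_measurable torus_borel"
  have "diagonal_average (\<lambda>x. c * f x) = (\<lambda>\<xi>. c * diagonal_average f \<xi>)"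
    by (simp add: diagonal_average_def[abs_def])
  then show "L (diagonal_average (\<lambda>x. c * f x)) = c * L (diagonal_average f)"
    using f by (simp add: sigma_functional_scale[OF L] bounded_measurable_diagonal_average)
next
  fix F :: "nat \<Rightarrow> complex ^ 'a \<Rightarrow> complex" and f C
  assume F: "\<And>n. F n \<in> borel_measurable torus_borel"
    "\<And>n x. x \<in> space torus_borel \<Longrightarrow> norm (F n x) \<le> C"
    "\<And>x. x \<in> space torus_borel \<Longrightarrow> (\<lambda>n. F n x) \<longlonglongrightarrow> f x"
  have f: "f \<in> borel_measurable torus_borel"
    by (rule borel_measurable_LIMSEQ_metric[OF F(1) F(3)])
  show "(\<lambda>n. L (diagonal_average (F n))) \<longlonglongrightarrow> L (diagonal_average f)"
  proof (rule sigma_functional_lim[OF L])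
    show "diagonal_average (F n) \<in> borel_measurable torus_borel" for n
      by (intro borel_measurable_diagonal_average F)
    fix \<xi> :: "complex ^ 'a" assume "\<xi> \<in> space torus_borel"
    then have \<xi>: "\<xi> \<in> torus" by simp
    show "norm (diagonal_average (F n) \<xi>) \<le> C" for n
      using F(2) \<xi> by (intro norm_diagonal_average_le) auto
    interpret prob_space circle_lebesgue by (rule prob_space_circle_lebesgue)
    have act: "w *s \<xi> \<in> torus" if "cmod w = 1" for w
      using \<xi> that by (simp add: torus_def norm_mult)
    show "(\<lambda>n. diagonal_average (F n) \<xi>) \<longlonglongrightarrow> diagonal_average f \<xi>"
      unfolding diagonal_average_def
      using F act
      by (intro integral_dominated_convergence[where w = "\<lambda>_. C"] AE_I2
          measurable_compose[OF measurable_diagonal_action_left[OF \<xi>]] f) auto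
  qed
qed

lemma power_int_sum:
  fixes z :: "'a :: field"
  assumes "z \<noteq> 0"
  shows "z powi (\<Sum>i\<in>I. f i) = (\<Prod>i\<in>I. z powi f i)"
  by (induction I rule: infinite_finite_induct) (use assms in \<open>auto simp: power_int_add\<close>)

text \<open>A rotation by w multiplies the character by a power of \<open>cnj w\<close> whose
  exponent is the coordinate sum of k, and nonzero powers integrate to 0.\<close>

lemma diagonal_average_torus_char:
  fixes k :: "int ^ 'n::finite"
  shows "diagonal_average (torus_char k) \<xi> = (if (\<Sum>i\<in>UNIV. k $ i) = 0 then torus_char k \<xi> else 0)"
proof -
  have "torus_char k (w *s \<xi>) = cnj w powi (\<Sum>i\<in>UNIV. k $ i) * torus_char k \<xi>" if "cmod w = 1" for w
  proof -
    have "w \<noteq> 0" using that by auto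
    then show ?thesis
      by (simp add: torus_char_def power_int_mult_distrib prod.distrib power_int_sum)
  qed
  then have "diagonal_average (torus_char k) \<xi> = (\<integral>w. cnj w powi (\<Sum>i\<in>UNIV. k $ i) * torus_char k \<xi> \<partial>circle_lebesgue)"
    unfolding diagonal_average_def by (intro Bochner_Integration.integral_cong) auto
  then show ?thesis
    by (simp add: integral_circle_lebesgue_powi)
qed

section \<open>The lower bound\<close>

lemma finite_vec_box: "finite {k :: int ^ 'n::finite. \<forall>i. \<bar>k $ i\<bar> \<le> b}"
proof -
  have "{k :: int ^ 'n. \<forall>i. \<bar>k $ i\<bar> \<le> b} \<subseteq> vec_lambda ` (PiE UNIV (\<lambda>_. {- b..b}))"
  proof
    fix k :: "int ^ 'n" assume "k \<in> {k. \<forall>i. \<bar>k $ i\<bar> \<le> b}"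
    then have "(\<lambda>i. k $ i) \<in> PiE UNIV (\<lambda>_. {- b..b})"
      by (auto simp: abs_le_iff minus_le_iff)
    then show "k \<in> vec_lambda ` (PiE UNIV (\<lambda>_. {- b..b}))"
      by (rule rev_image_eqI) simp
  qed
  then show ?thesis
    by (rule finite_subset) (intro finite_imageI finite_PiE, auto)
qed

text \<open>Entries of one sign cannot cancel, so each is bounded by the absolute value of the sum.
  This is the only place where the shape of the permitted spectrum is exploited.\<close>

lemma finite_one_signed_fixed_sum:
  "finite {k :: int ^ 'n::finite. (\<Sum>i\<in>UNIV. k $ i) = s \<and> ((\<forall>i. k $ i \<le> 0) \<or> (\<forall>i. 0 \<le> k $ i))}"
proof (rule finite_subset[OF _ finite_vec_box])
  show "{k :: int ^ 'n. (\<Sum>i\<in>UNIV. k $ i) = s \<and> ((\<forall>i. k $ i \<le> 0) \<or> (\<forall>i. 0 \<le> k $ i))}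
      \<subseteq> {k. \<forall>i. \<bar>k $ i\<bar> \<le> \<bar>s\<bar>}"
  proof (intro subsetI CollectI allI)
    fix k :: "int ^ 'n" and i
    assume "k \<in> {k. (\<Sum>i\<in>UNIV. k $ i) = s \<and> ((\<forall>i. k $ i \<le> 0) \<or> (\<forall>i. 0 \<le> k $ i))}"
    then consider "(\<Sum>i\<in>UNIV. k $ i) = s" "\<forall>i. k $ i \<le> 0" | "(\<Sum>i\<in>UNIV. k $ i) = s" "\<forall>i. 0 \<le> k $ i"
      by blast
    then show "\<bar>k $ i\<bar> \<le> \<bar>s\<bar>"
    proof cases
      case 1
      then have "- k $ i \<le> (\<Sum>i\<in>UNIV. - k $ i)"
        using member_le_sum[of i UNIV "\<lambda>i. - k $ i"] by simp
      with 1 have "- k $ i \<le> - s"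
        by (simp add: sum_negf)
      with 1 show ?thesis using 1(2)[rule_format, of i] by linarith
    next
      case 2
      then have "k $ i \<le> (\<Sum>i\<in>UNIV. k $ i)"
        using member_le_sum[of i UNIV "\<lambda>i. k $ i"] by simp
      with 2 show ?thesis using 2(2)[rule_format, of i] by linarith
    qed
  qed
qed

lemma fourier_coeff_torus_char:
  "fourier_coeff \<mu> k = complex_measure_integral torus_borel \<mu> (torus_char k)"
  by (simp add: fourier_coeff_def torus_char_def[abs_def])

definition diagonal_invariant :: "(complex ^ 'n) set \<Rightarrow> bool" where
  "diagonal_invariant B \<longleftrightarrow> (\<forall>\<xi> w. cmod w = 1 \<longrightarrow> (w *s \<xi> \<in> B \<longleftrightarrow> \<xi> \<in> B))"

lemma diagonal_average_indicator:
  assumes "diagonal_invariant B"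
  shows "diagonal_average (indicator B) \<xi> = indicator B \<xi>"
proof -
  interpret prob_space circle_lebesgue by (rule prob_space_circle_lebesgue)
  have "diagonal_average (indicator B) \<xi> = (\<integral>w. indicator B \<xi> \<partial>circle_lebesgue)"
    unfolding diagonal_average_def using assms
    by (intro Bochner_Integration.integral_cong) (auto simp: indicator_def diagonal_invariant_def)
  then show ?thesis
    by (simp add: prob_space[simplified])
qed

text \<open>The conclusion covers every measurable A inside B because \<open>\<mu> B = 0\<close>
  alone could result from cancellation; total variation needs all the pieces.\<close>

lemma pluriharmonic_invariant_null:
  fixes \<mu> :: "(complex ^ 'n::finite) set \<Rightarrow> complex"
  assumes ph: "pluriharmonic \<mu>" and B: "B \<in> sets torus_borel" "diagonal_invariant B"
    and null: "emeasure haar B = 0" and A: "A \<in> sets torus_borel" "A \<subseteq> B"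
  shows "\<mu> A = 0"
proof -
  define I where "I = complex_measure_integral torus_borel \<mu>"
  have cm: "complex_measure torus_borel \<mu>"
    using ph by (simp add: pluriharmonic_def)
  have I: "sigma_functional torus_borel I"
    unfolding I_def using cm by (rule sigma_functional_complex_measure_integral)
  interpret haar: prob_space "haar :: (complex ^ 'n) measure" by (rule prob_space_haar)
  have H: "sigma_functional torus_borel (\<lambda>f. \<integral>\<xi>. f \<xi> \<partial>(haar :: (complex ^ 'n) measure))"
    by (intro sigma_functional_integral haar.finite_measure_axioms sets_haar)
  have zero: "I (\<lambda>\<xi>. 0) = 0"
    using sigma_functional_scale[OF I bounded_measurable_const[of 0], of 0] by simp
  have char: "I (\<lambda>\<xi>. indicator B \<xi> * torus_char m \<xi>) = 0" for m
  proof -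
    \<comment> \<open>The shifted frequencies \<open>m + k\<close> all have the coordinate sum of m,
      and pluriharmonicity makes those with nonzero coefficient one-signed.\<close>
    define S where "S = {k. (\<Sum>i\<in>UNIV. k $ i) = 0 \<and> I (torus_char (m + k)) \<noteq> 0}"
    \<comment> \<open>The sign in \<open>torus_char (- k)\<close> comes from orthogonality: against
      \<open>haar\<close>, the product with \<open>torus_char k\<close> isolates the coefficient at
      k.\<close>
    define p where "p \<xi> = (\<Sum>k\<in>S. I (torus_char (m + k)) * torus_char (- k) \<xi>)" for \<xi>
    have "finite S"
    proof (rule finite_subset)
      let ?F = "{k :: int ^ 'n. (\<Sum>i\<in>UNIV. k $ i) = (\<Sum>i\<in>UNIV. m $ i) \<and>
        ((\<forall>i. k $ i \<le> 0) \<or> (\<forall>i. 0 \<le> k $ i))}"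
      show "S \<subseteq> (\<lambda>k. k - m) ` ?F"
      proof
        fix k assume k: "k \<in> S"
        have "(\<forall>i. (m + k) $ i \<le> 0) \<or> (\<forall>i. 0 \<le> (m + k) $ i)"
          using k ph unfolding S_def pluriharmonic_def fourier_coeff_torus_char I_def by blast
        moreover have "(\<Sum>i\<in>UNIV. (m + k) $ i) = (\<Sum>i\<in>UNIV. m $ i)"
          using k by (simp add: S_def sum.distrib)
        ultimately have "m + k \<in> ?F" by blast
        then show "k \<in> (\<lambda>k. k - m) ` ?F"
          by (rule rev_image_eqI) simp
      qed
      show "finite ((\<lambda>k. k - m) ` ?F)"
        by (intro finite_imageI finite_one_signed_fixed_sum)
    qed
    have p: "p \<in> bounded_measurable torus_borel"
      unfolding p_def[abs_def]
      by (intro bounded_measurable_sum bounded_measurable_mult bounded_measurable_const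
          bounded_measurable_torus_char)
    \<comment> \<open>L is the averaged, weighted functional minus integration against p. It kills
      every character, hence also the indicator of B.\<close>
    define L where "L f = I (\<lambda>\<xi>. diagonal_average f \<xi> * torus_char m \<xi>) - (\<integral>\<xi>. f \<xi> * p \<xi> \<partial>haar)" for f
    have L: "sigma_functional torus_borel L"
      unfolding L_def[abs_def]
      by (intro sigma_functional_minus sigma_functional_mult[OF H p]
          sigma_functional_diagonal_average[OF sigma_functional_mult[OF I bounded_measurable_torus_char]])
    have "L (torus_char k) = 0" for k
    proof -
      have bm: "(\<lambda>\<xi>. c * torus_char l \<xi>) \<in> bounded_measurable torus_borel" for c and l :: "int ^ 'n"
        by (intro bounded_measurable_mult bounded_measurable_const bounded_measurable_torus_char)
      have "(\<integral>\<xi>. torus_char k \<xi> * p \<xi> \<partial>haar)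
          = (\<integral>\<xi>. (\<Sum>l\<in>S. I (torus_char (m + l)) * torus_char (k - l) \<xi>) \<partial>haar)"
      proof (rule sigma_functional_cong[OF H])
        show "(\<lambda>\<xi>. \<Sum>l\<in>S. I (torus_char (m + l)) * torus_char (k - l) \<xi>) \<in> bounded_measurable torus_borel"
          by (intro bounded_measurable_sum bm)
        fix \<xi> :: "complex ^ 'n" assume "\<xi> \<in> space torus_borel"
        then have "torus_char (k - l) \<xi> = torus_char k \<xi> * torus_char (- l) \<xi>" for l
          using torus_char_add[of \<xi> k "- l"] by simp
        then show "torus_char k \<xi> * p \<xi> = (\<Sum>l\<in>S. I (torus_char (m + l)) * torus_char (k - l) \<xi>)"
          by (simp add: p_def sum_distrib_left mult_ac)
      qed
      also have "\<dots> = (\<Sum>l\<in>S. \<integral>\<xi>. I (torus_char (m + l)) * torus_char (k - l) \<xi> \<partial>haar)"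
        by (rule sigma_functional_sum[OF H bm])
      also have "\<dots> = (\<Sum>l\<in>S. if l = k then I (torus_char (m + l)) else 0)"
        by (intro sum.cong refl) (simp add: integral_torus_char_haar)
      also have "\<dots> = (if k \<in> S then I (torus_char (m + k)) else 0)"
        using \<open>finite S\<close> by simp
      also have "\<dots> = I (\<lambda>\<xi>. diagonal_average (torus_char k) \<xi> * torus_char m \<xi>)"
      proof (cases "(\<Sum>i\<in>UNIV. k $ i) = 0")
        case True
        have "I (\<lambda>\<xi>. diagonal_average (torus_char k) \<xi> * torus_char m \<xi>) = I (torus_char (m + k))"
          by (rule sigma_functional_cong[OF I bounded_measurable_torus_char])
            (simp add: diagonal_average_torus_char True torus_char_add)
        then show ?thesis using True by (simp add: S_def)
      next
        case False
        then show ?thesis by (simp add: diagonal_average_torus_char S_def zero)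
      qed
      finally show ?thesis by (simp add: L_def)
    qed
    then have "L (indicator B) = 0"
      by (rule sigma_functional_Fourier_unique[OF L _ B(1)])
    moreover have "(\<integral>\<xi>. indicator B \<xi> * p \<xi> \<partial>haar) = 0"
    proof (rule integral_eq_zero_AE)
      have "AE \<xi> in haar. \<xi> \<notin> B"
        using null B(1) by (intro AE_not_in null_setsI) auto
      then show "AE \<xi> in haar. indicator B \<xi> * p \<xi> = 0"
        by eventually_elim simp
    qed
    ultimately show ?thesis
      by (simp add: L_def diagonal_average_indicator[OF B(2)])
  qed
  \<comment> \<open>By \<open>char\<close>, all Fourier coefficients of the restriction of \<mu> to
    B vanish, so uniqueness applies a second time.\<close>
  have L': "sigma_functional torus_borel (\<lambda>f. I (\<lambda>\<xi>. f \<xi> * indicator B \<xi>))"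
    by (intro sigma_functional_mult I bounded_measurable_indicator B)
  have "I (\<lambda>\<xi>. indicator A \<xi> * indicator B \<xi>) = 0"
    by (rule sigma_functional_Fourier_unique[OF L' _ A(1)]) (simp add: char mult.commute)
  moreover have "(\<lambda>\<xi>. indicator A \<xi> * indicator B \<xi>) = (indicator A :: complex ^ 'n \<Rightarrow> complex)"
    using A(2) by (auto simp: fun_eq_iff indicator_def)
  ultimately show ?thesis
    by (simp add: I_def complex_measure_integral_indicator[OF cm A(1)])
qed

section \<open>Invariant covers of Hausdorff-null sets\<close>

lemma diagonal_invariant_tube: "diagonal_invariant (diagonal_tube j c r :: (complex ^ 'n::finite) set)"
  unfolding diagonal_invariant_def
proof (intro allI impI)
  fix \<xi> :: "complex ^ 'n" and w :: complex assume w: "cmod w = 1"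
  then have "w * cnj w = 1"
    by (simp add: complex_norm_square[symmetric])
  then have "w * a * cnj (w * b) = a * cnj b" for a b
    by (metis complex_cnj_mult mult.assoc mult.left_commute mult_1)
  then show "w *s \<xi> \<in> diagonal_tube j c r \<longleftrightarrow> \<xi> \<in> diagonal_tube j c r"
    unfolding diagonal_tube_def torus_def mem_Collect_eq vector_smult_component
    by (simp only: norm_mult w mult_1)
qed

text \<open>For a diameter at most 1, lowering the exponent raises the power. The cases s = 0 (gauge
  1) and diameter 0 (where \<open>d > 0\<close> gives the power 0) are treated apart because of the
  conventions for \<open>powr\<close>.\<close>

lemma diameter_power_le_gauge:
  assumes "0 \<le> s" "s \<le> real d" "d > 0" "U \<noteq> {}" "bounded U" "diameter U \<le> 1"
  shows "ennreal (diameter U ^ d) \<le> hausdorff_gauge s U"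
proof (cases "s = 0")
  case True
  then show ?thesis
    using assms diameter_ge_0[OF assms(5)] by (simp add: hausdorff_gauge_def power_le_one)
next
  case False
  have "diameter U ^ d \<le> diameter U powr s"
  proof (cases "diameter U = 0")
    case True
    then show ?thesis using assms(3) by (simp add: zero_power)
  next
    case False
    then have "diameter U > 0" using diameter_ge_0[OF assms(5)] by simp
    then show ?thesis
      using assms powr_mono'[of s "real d" "diameter U"] by (simp add: powr_realpow)
  qed
  then show ?thesis
    using False assms(4) by (simp add: hausdorff_gauge_def ennreal_leI)
qed

text \<open>The sum is at most twice the maximum. This separates the diameter from the padding in
  the tube radius.\<close>

lemma power_add_le:
  fixes a b :: real
  assumes "0 \<le> a" "0 \<le> b"
  shows "(a + b) ^ d \<le> 2 ^ d * (a ^ d + b ^ d)"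
proof -
  have "(a + b) ^ d \<le> (2 * max a b) ^ d"
    using assms by (intro power_mono) auto
  also have "\<dots> = 2 ^ d * max a b ^ d"
    by (rule power_mult_distrib)
  also have "max a b ^ d \<le> a ^ d + b ^ d"
    using assms by (auto simp: max_def)
  finally show ?thesis by simp
qed

text \<open>Each covering set that meets E is enlarged to the tube around one of its points in E;
  the Haar measure of the tube is controlled by the gauge of the set plus a summable
  padding.\<close>

lemma small_set_covered_by_tubes:
  fixes E :: "(complex ^ 'n::finite) set"
  assumes card: "CARD('n) \<ge> 2" and E: "E \<subseteq> torus" and s: "0 \<le> s" "s \<le> real (CARD('n) - 1)"
    and null: "hausdorff_measure s E = 0" and e: "0 < e" "e \<le> 1"
  obtains V where "V \<in> sets torus_borel" "E \<subseteq> V" "diagonal_invariant V"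
    "emeasure haar V \<le> ennreal (2 * 4 ^ (CARD('n) - 1) * e)"
proof -
  define d where "d = CARD('n) - 1"
  have d: "d > 0" using card by (simp add: d_def)
  obtain j :: 'n where True by simp
  \<comment> \<open>Vanishing of the supremum forces the premeasure to vanish at scale 1, and
    diameters at most 1 are what the comparison of exponents requires.\<close>
  have "hausdorff_premeasure s 1 E \<le> hausdorff_measure s E"
    unfolding hausdorff_measure_def by (intro SUP_upper) auto
  then have "hausdorff_premeasure s 1 E < ennreal e"
    using null e by simp
  then obtain U :: "nat \<Rightarrow> (complex ^ 'n) set"
    where U: "E \<subseteq> (\<Union>i. U i)" "\<And>i. bounded (U i)" "\<And>i. diameter (U i) \<le> 1"
      "(\<Sum>i. hausdorff_gauge s (U i)) < ennreal e"
    unfolding hausdorff_premeasure_def INF_less_iff by auto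
  \<comment> \<open>The padding keeps radii positive for sets of diameter 0 and makes the tube
    inequality strict; the geometric weights sum to e.\<close>
  define \<eta> where "\<eta> i = e * (1/2) ^ Suc i" for i
  have \<eta>: "\<eta> i > 0" "\<eta> i \<le> 1" for i
  proof -
    show "\<eta> i > 0" using e by (simp add: \<eta>_def)
    show "\<eta> i \<le> 1"
      unfolding \<eta>_def using e by (intro mult_le_one power_le_one zero_le_power) auto
  qed
  \<comment> \<open>The factor 2 arises because both factors of a product of unimodular numbers
    move, each by at most the diameter.\<close>
  define \<rho> where "\<rho> i = 2 * diameter (U i) + \<eta> i" for i
  have diam: "diameter (U i) \<ge> 0" for i
    by (intro diameter_ge_0 U)
  have \<rho>: "\<rho> i > 0" for i
    using \<eta>[of i] diam[of i] by (simp add: \<rho>_def)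
  define c where "c i = (SOME x. x \<in> U i \<inter> E)" for i
  have c: "c i \<in> U i \<inter> E" if "U i \<inter> E \<noteq> {}" for i
    unfolding c_def using that by (simp only: some_in_eq simp_thms)
  \<comment> \<open>Sets missing E are dropped: they need not touch the torus, where the centre of a
    tube must lie.\<close>
  define W where "W i = (if U i \<inter> E = {} then {} else diagonal_tube j (c i) (\<rho> i))" for i
  have W_sets: "W i \<in> sets torus_borel" for i
    by (simp add: W_def diagonal_tube_sets)
  have W_cover: "U i \<inter> E \<subseteq> W i" for i
  proof
    fix \<xi> assume \<xi>: "\<xi> \<in> U i \<inter> E"
    have ci: "c i \<in> U i \<inter> E" using \<xi> by (intro c) auto
    have "dist \<xi> (c i) \<le> diameter (U i)"
      using \<xi> ci by (intro diameter_bounded_bound U) auto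
    then have comp: "norm (\<xi> $ a - c i $ a) \<le> diameter (U i)" for a
      using order_trans[OF Finite_Cartesian_Product.norm_nth_le[where x = "\<xi> - c i" and i = a]] by (simp add: dist_norm)
    have "norm (\<xi> $ a * cnj (\<xi> $ j) - c i $ a * cnj (c i $ j)) < \<rho> i" for a
    proof -
      have "\<xi> $ a * cnj (\<xi> $ j) - c i $ a * cnj (c i $ j)
          = (\<xi> $ a - c i $ a) * cnj (\<xi> $ j) + c i $ a * cnj (\<xi> $ j - c i $ j)"
        by (simp add: algebra_simps)
      also have "norm \<dots> \<le> norm ((\<xi> $ a - c i $ a) * cnj (\<xi> $ j)) + norm (c i $ a * cnj (\<xi> $ j - c i $ j))"
        by (rule norm_triangle_ineq)
      also have "\<dots> = norm (\<xi> $ a - c i $ a) + norm (\<xi> $ j - c i $ j)"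
      proof -
        have "\<xi> \<in> torus" "c i \<in> torus" using \<xi> ci E by auto
        then show ?thesis
          by (simp only: norm_mult complex_mod_cnj torus_norm_nth mult_1 mult_1_right)
      qed
      also have "\<dots> \<le> 2 * diameter (U i)"
        using comp[of a] comp[of j] by simp
      also have "\<dots> < \<rho> i"
        using \<eta>[of i] by (simp add: \<rho>_def)
      finally show ?thesis .
    qed
    then show "\<xi> \<in> W i"
      using \<xi> E by (auto simp: W_def diagonal_tube_def)
  qed
  have W_small: "emeasure haar (W i) \<le> ennreal (4 ^ d) * hausdorff_gauge s (U i) + ennreal (2 ^ d * \<eta> i)" for i
  proof (cases "U i \<inter> E = {}")
    case False
    have "c i \<in> torus" using c[OF False] E by auto
    then have "emeasure haar (W i) \<le> ennreal (\<rho> i ^ d)"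
      using False emeasure_haar_diagonal_tube[OF _ \<rho>] by (simp add: W_def d_def)
    \<comment> \<open>Splitting the sum costs \<open>2 ^ d\<close>, which with
      \<open>(2 * diameter (U i)) ^ d\<close> makes \<open>4 ^ d\<close>. Since \<eta> is at most 1
      and d at least 1, its power is then replaced by \<eta> itself, whose sum is known.\<close>
    also have "\<rho> i ^ d \<le> 2 ^ d * ((2 * diameter (U i)) ^ d + \<eta> i ^ d)"
      unfolding \<rho>_def using diam[of i] \<eta>[of i] by (intro power_add_le) auto
    also have "\<dots> \<le> 2 ^ d * ((2 * diameter (U i)) ^ d + \<eta> i)"
    proof -
      have "\<eta> i ^ d \<le> \<eta> i"
        using power_decreasing[of 1 d "\<eta> i"] \<eta>[of i] d by simp
      then show ?thesis by simp
    qed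
    also have "\<dots> = 4 ^ d * diameter (U i) ^ d + 2 ^ d * \<eta> i"
    proof -
      have "(4::real) ^ d = 2 ^ d * 2 ^ d"
        by (simp flip: power_mult_distrib)
      then show ?thesis
        by (simp add: power_mult_distrib distrib_left)
    qed
    finally have "emeasure haar (W i) \<le> ennreal (4 ^ d * diameter (U i) ^ d + 2 ^ d * \<eta> i)"
      by (simp add: ennreal_leI)
    also have "\<dots> = ennreal (4 ^ d) * ennreal (diameter (U i) ^ d) + ennreal (2 ^ d * \<eta> i)"
      using diam[of i] \<eta>[of i] by (simp add: ennreal_plus ennreal_mult)
    also have "\<dots> \<le> ennreal (4 ^ d) * hausdorff_gauge s (U i) + ennreal (2 ^ d * \<eta> i)"
      using False s d U by (intro add_right_mono mult_left_mono diameter_power_le_gauge) (auto simp: d_def)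
    finally show ?thesis .
  qed (simp add: W_def)
  show ?thesis
  proof (rule that[of "\<Union>i. W i"])
    show "(\<Union>i. W i) \<in> sets torus_borel"
      using W_sets by (intro sets.countable_UN) auto
    show "E \<subseteq> (\<Union>i. W i)"
      using U(1) W_cover by fastforce
    have "diagonal_invariant (W i)" for i
      by (auto simp: W_def diagonal_invariant_tube) (simp add: diagonal_invariant_def)
    then show "diagonal_invariant (\<Union>i. W i)"
      by (simp add: diagonal_invariant_def)
    have "(\<lambda>i. 2 ^ d * \<eta> i) sums (2 ^ d * (e * 1))"
      unfolding \<eta>_def by (intro sums_mult power_half_series)
    then have \<eta>_sum: "(\<Sum>i. ennreal (2 ^ d * \<eta> i)) = ennreal (2 ^ d * e)"
      using \<eta> by (intro suminf_ennreal_eq) (auto simp: less_imp_le)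
    have "emeasure haar (\<Union>i. W i) \<le> (\<Sum>i. emeasure haar (W i))"
      using W_sets by (intro emeasure_subadditive_countably) auto
    also have "\<dots> \<le> (\<Sum>i. ennreal (4 ^ d) * hausdorff_gauge s (U i) + ennreal (2 ^ d * \<eta> i))"
      by (intro suminf_le W_small summableI)
    also have "\<dots> = ennreal (4 ^ d) * (\<Sum>i. hausdorff_gauge s (U i)) + ennreal (2 ^ d * e)"
      by (simp add: suminf_add[symmetric] summableI ennreal_suminf_cmult \<eta>_sum)
    also have "\<dots> \<le> ennreal (4 ^ d) * ennreal e + ennreal (2 ^ d * e)"
      using U(4) by (intro add_right_mono mult_left_mono) auto
    also have "\<dots> = ennreal (4 ^ d * e + 2 ^ d * e)"
      using e by (simp add: ennreal_plus ennreal_mult)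
    also have "\<dots> \<le> ennreal (2 * 4 ^ d * e)"
      using e power_mono[of 2 "4::real" d] by (intro ennreal_leI) (simp add: algebra_simps)
    finally show "emeasure haar (\<Union>i. W i) \<le> ennreal (2 * 4 ^ (CARD('n) - 1) * e)"
      by (simp add: d_def)
  qed
qed

text \<open>Intersect the covers obtained for \<open>e = 1 / (n + 1)\<close>; invariance and
  measurability survive countable intersections.\<close>

lemma hausdorff_null_subset_invariant_null:
  fixes E :: "(complex ^ 'n::finite) set"
  assumes card: "CARD('n) \<ge> 2" and E: "E \<subseteq> torus" and s: "0 \<le> s" "s \<le> real (CARD('n) - 1)"
    and null: "hausdorff_measure s E = 0"
  obtains B where "B \<in> sets torus_borel" "E \<subseteq> B" "diagonal_invariant B" "emeasure haar B = 0"
proof -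
  let ?K = "2 * 4 ^ (CARD('n) - 1) :: real"
  have "\<exists>V. V \<in> sets torus_borel \<and> E \<subseteq> V \<and> diagonal_invariant V \<and>
      emeasure haar V \<le> ennreal (?K * inverse (real (Suc n)))" for n
  proof -
    have "0 < inverse (real (Suc n))" "inverse (real (Suc n)) \<le> 1"
      by (auto simp: inverse_le_1_iff)
    from small_set_covered_by_tubes[OF card E s null this] show ?thesis
      by (metis (no_types))
  qed
  then obtain V where V: "\<And>n. V n \<in> sets torus_borel" "\<And>n. E \<subseteq> V n" "\<And>n. diagonal_invariant (V n)"
      "\<And>n. emeasure haar (V n) \<le> ennreal (?K * inverse (real (Suc n)))"
    by metis
  show ?thesis
  proof (rule that[of "\<Inter>n. V n"])
    show "(\<Inter>n. V n) \<in> sets torus_borel"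
      using V(1) by (intro sets.countable_INT) auto
    show "E \<subseteq> (\<Inter>n. V n)" using V(2) by auto
    show "diagonal_invariant (\<Inter>n. V n)"
      using V(3) by (simp add: diagonal_invariant_def)
    have "(\<lambda>n. ?K * inverse (real (Suc n))) \<longlonglongrightarrow> ?K * 0"
      by (intro tendsto_intros LIMSEQ_inverse_real_of_nat)
    then have lim: "(\<lambda>n. ennreal (?K * inverse (real (Suc n)))) \<longlonglongrightarrow> ennreal (?K * 0)"
      by (rule tendsto_ennrealI)
    have "emeasure haar (\<Inter>n. V n) \<le> ennreal (?K * inverse (real (Suc n)))" for n
      using V(1) by (intro order_trans[OF emeasure_mono V(4)]) auto
    then have "emeasure haar (\<Inter>n. V n) \<le> ennreal (?K * 0)"
      by (intro LIMSEQ_le_const[OF lim]) blast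
    then show "emeasure haar (\<Inter>n. V n) = 0" by simp
  qed
qed

text \<open>A charged set of smaller dimension would be null for some exponent s below n-1, hence
  contained in an invariant Haar-null B. Every piece of every partition of it lies in B and has
  value 0, so its total variation is 0.\<close>

lemma pluriharmonic_dim_ge:
  fixes \<mu> :: "(complex ^ 'n::finite) set \<Rightarrow> complex"
  assumes card: "CARD('n) \<ge> 2" and ph: "pluriharmonic \<mu>"
  shows "ereal (real CARD('n) - 1) \<le> measure_hausdorff_dim torus_borel \<mu>"
  unfolding measure_hausdorff_dim_def
proof (rule INF_greatest, rule ccontr)
  fix E :: "(complex ^ 'n) set"
  assume "E \<in> {E \<in> sets torus_borel. 0 < total_variation torus_borel \<mu> E}"
  then have E: "E \<in> sets torus_borel" "0 < total_variation torus_borel \<mu> E" by auto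
  assume "\<not> ereal (real CARD('n) - 1) \<le> hausdorff_dim E"
  then obtain s where s: "0 \<le> s" "hausdorff_measure s E = 0" "s < real CARD('n) - 1"
    unfolding not_le hausdorff_dim_def INF_less_iff by auto
  have "E \<subseteq> torus"
    using sets.sets_into_space[OF E(1)] by simp
  moreover have "s \<le> real (CARD('n) - 1)"
    using s(3) card by (simp add: of_nat_diff)
  ultimately obtain B where B: "B \<in> sets torus_borel" "E \<subseteq> B" "diagonal_invariant B" "emeasure haar B = 0"
    using hausdorff_null_subset_invariant_null[OF card _ s(1) _ s(2)] by blast
  have "total_variation torus_borel \<mu> E \<le> 0"
    unfolding total_variation_def
  proof (rule SUP_least, clarify)
    fix A :: "nat \<Rightarrow> (complex ^ 'n) set"
    assume A: "range A \<subseteq> sets torus_borel" "E = (\<Union>i. A i)"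
    have "\<mu> (A i) = 0" for i
      using A B(2) by (intro pluriharmonic_invariant_null[OF ph B(1,3,4)]) auto
    then show "(\<Sum>i. ennreal (norm (\<mu> (A i)))) \<le> 0" by simp
  qed
  then show False using E(2) by simp
qed

section \<open>Sharpness\<close>

lemma dirac_lebesgue_torus_prod:
  "dirac_lebesgue j = torus_prod (\<lambda>i. if i = j then return circle_borel 1 else circle_lebesgue)"
  by (simp add: dirac_lebesgue_def torus_prod_def)

lemma dirac_factor:
  "prob_space (if i = j then return circle_borel 1 else circle_lebesgue)"
  "sets (if i = j then return circle_borel 1 else circle_lebesgue) = sets circle_borel"
  by (auto intro!: prob_space_return prob_space_circle_lebesgue)

lemma finite_measure_dirac_lebesgue: "finite_measure (dirac_lebesgue j)"
  unfolding dirac_lebesgue_torus_prod by (intro finite_measure_torus_prod dirac_factor)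

lemma sets_dirac_lebesgue: "sets (dirac_lebesgue j) = sets torus_borel"
  by (simp add: dirac_lebesgue_torus_prod)

lemma integral_torus_char_dirac_lebesgue:
  assumes "i \<noteq> j" "k $ i \<noteq> 0"
  shows "(\<integral>\<xi>. torus_char k \<xi> \<partial>dirac_lebesgue j) = 0"
proof -
  have "(\<integral>\<xi>. torus_char k \<xi> \<partial>dirac_lebesgue j)
      = (\<Prod>i\<in>UNIV. \<integral>z. cnj z powi (k $ i) \<partial>(if i = j then return circle_borel 1 else circle_lebesgue))"
    unfolding dirac_lebesgue_torus_prod by (intro integral_torus_char_torus_prod dirac_factor)
  also have "\<dots> = 0"
    using assms by (intro prod_zero[OF finite] bexI[of _ i]) (simp_all add: integral_circle_lebesgue_powi)
  finally show ?thesis .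
qed

lemma complex_measure_of_real_measure:
  assumes "finite_measure N" "sets N = sets M"
  shows "complex_measure M (\<lambda>E. complex_of_real (measure N E))"
  using countably_additive_on_measure[OF assms]
  unfolding countably_additive_on_def by (auto intro: sums_of_real)

lemma complex_measure_integral_of_real_measure:
  assumes "finite_measure N" "sets N = sets M"
  shows "complex_measure_integral M (\<lambda>E. complex_of_real (measure N E)) f = (\<integral>x. f x \<partial>N)"
proof -
  \<comment> \<open>The imaginary part is the zero set function, realized as the
    \<open>measure\<close> of \<open>null_measure M\<close> so that the formula for positive
    measures evaluates its integral.\<close>
  have "finite_measure (null_measure M)"
    by (rule finite_measureI) simp
  from real_measure_integral_measure[OF this, of M f]
  have "real_measure_integral M (measure (null_measure M)) f = 0"
    by simp
  moreover have "measure (null_measure M) = (\<lambda>E. 0)"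
    by (simp add: measure_def fun_eq_iff)
  ultimately have "real_measure_integral M (\<lambda>E. 0) f = 0"
    by simp
  then show ?thesis
    by (simp add: complex_measure_integral_def real_measure_integral_measure[OF assms])
qed

text \<open>A forbidden k has a positive and a negative entry. These sit at different coordinates,
  so at least one of them belongs to a Lebesgue factor, whose integral is 0.\<close>

lemma pluriharmonic_dirac_lebesgue:
  "pluriharmonic (\<lambda>E. complex_of_real (measure (dirac_lebesgue j) E))"
  unfolding pluriharmonic_def
proof (intro conjI allI impI)
  show "complex_measure torus_borel (\<lambda>E. complex_of_real (measure (dirac_lebesgue j) E))"
    by (intro complex_measure_of_real_measure finite_measure_dirac_lebesgue sets_dirac_lebesgue)
  fix k :: "int ^ 'a" assume "\<not> (\<forall>i. k $ i \<le> 0) \<and> \<not> (\<forall>i. 0 \<le> k $ i)"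
  then obtain a b where ab: "k $ a > 0" "k $ b < 0"
    by (auto simp: not_le)
  have "\<exists>i. i \<noteq> j \<and> k $ i \<noteq> 0"
  proof (cases "a = j")
    case True
    then show ?thesis using ab by (intro exI[of _ b]) auto
  next
    case False
    then show ?thesis using ab by (intro exI[of _ a]) auto
  qed
  then obtain i where "i \<noteq> j" "k $ i \<noteq> 0" by blast
  then show "fourier_coeff (\<lambda>E. complex_of_real (measure (dirac_lebesgue j) E)) k = 0"
    by (simp add: fourier_coeff_torus_char complex_measure_integral_of_real_measure
        finite_measure_dirac_lebesgue sets_dirac_lebesgue integral_torus_char_dirac_lebesgue)
qed

section \<open>Upper bound for the dimension of the slice carrying the mass\<close>

definition torus_slice :: "'n \<Rightarrow> (complex ^ 'n) set" where
  "torus_slice j = {\<xi> \<in> torus. \<xi> $ j = 1}"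

lemma torus_slice_sets: "torus_slice j \<in> sets (torus_borel :: (complex ^ 'n::finite) measure)"
proof -
  have "closed {\<xi> :: complex ^ 'n. \<xi> $ j = 1}"
    by (intro closed_Collect_eq continuous_intros)
  then show ?thesis
    unfolding torus_borel_def sets_restrict_space torus_slice_def
    by (intro image_eqI[of _ _ "{\<xi>. \<xi> $ j = 1}"]) auto
qed

text \<open>The preimage of the slice is a box with j-th side \<open>{1}\<close> and full circles
  elsewhere, so every factor has mass 1.\<close>

lemma measure_dirac_lebesgue_slice: "measure (dirac_lebesgue j) (torus_slice j) = 1"
proof -
  let ?N = "\<lambda>i. if i = j then return circle_borel 1 else circle_lebesgue"
  let ?A = "\<lambda>i. if i = j then {1} else space circle_borel"
  interpret product_sigma_finite ?N
    by (intro product_sigma_finite.intro prob_space_imp_sigma_finite dirac_factor)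
  have vl: "vec_lambda \<in> measurable (PiM UNIV ?N) torus_borel"
    by (intro measurable_vec_lambda dirac_factor)
  have one: "{1} \<in> sets circle_borel"
    unfolding circle_borel_def by (auto simp: sets_restrict_space image_iff intro!: bexI[of _ "{1}"])
  have "vec_lambda -` torus_slice j \<inter> space (PiM UNIV ?N) = PiE UNIV ?A"
    by (auto simp: torus_slice_def torus_def space_PiM PiE_iff split: if_splits)
  then have "emeasure (dirac_lebesgue j) (torus_slice j) = emeasure (PiM UNIV ?N) (PiE UNIV ?A)"
    unfolding dirac_lebesgue_def by (simp add: emeasure_distr[OF vl torus_slice_sets])
  also have "\<dots> = (\<Prod>i\<in>UNIV. emeasure (?N i) (?A i))"
    using one sets.top[of circle_borel] by (intro emeasure_PiM) auto
  also have "\<dots> = 1"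
    using one prob_space.emeasure_space_1[OF prob_space_circle_lebesgue]
    by (intro prod.neutral ballI) auto
  finally show ?thesis by (simp add: measure_def)
qed

lemma norm_cis_diff_le: "norm (cis a - cis b) \<le> \<bar>a - b\<bar>"
proof -
  have "cis a - cis b = cis b * (cis (a - b) - 1)"
    by (simp add: right_diff_distrib cis_mult)
  then have "norm (cis a - cis b) = norm (exp (\<i> * of_real (a - b)) - 1)"
    by (simp add: norm_mult cis_conv_exp)
  also have "\<dots> = 2 * \<bar>sin ((a - b) / 2)\<bar>"
    by (rule dist_exp_i_1)
  also have "\<dots> \<le> \<bar>a - b\<bar>"
    using abs_sin_x_le_abs_x[of "(a - b) / 2"] by simp
  finally show ?thesis .
qed

lemma unimodular_cis:
  assumes "cmod z = 1"
  obtains t where "0 \<le> t" "t < 1" "z = cis (2 * pi * t)"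
proof -
  obtain a where a: "0 \<le> a" "a < 2 * pi" "z = Complex (cos a) (sin a)"
    using complex_unimodular_polar[OF assms] by auto
  then show ?thesis
    by (intro that[of "a / (2 * pi)"]) (auto simp: cis.code field_simps)
qed

text \<open>A grid cell of side 1/N in the angle parameters. Scaling by N makes \<open>g i\<close>
  the floor of \<open>N * t\<close>; closed cells overlap at their boundaries, which is harmless for
  a cover.\<close>

definition slice_cell :: "'n \<Rightarrow> nat \<Rightarrow> ('n \<Rightarrow> nat) \<Rightarrow> (complex ^ 'n) set" where
  "slice_cell j N g = {\<xi> \<in> torus. \<xi> $ j = 1 \<and>
     (\<forall>i. i \<noteq> j \<longrightarrow> (\<exists>t. real (g i) \<le> N * t \<and> N * t \<le> real (g i) + 1 \<and> \<xi> $ i = cis (2 * pi * t)))}"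

lemma diameter_slice_cell:
  fixes j :: "'n::finite"
  assumes "N > 0"
  shows "diameter (slice_cell j N g) \<le> CARD('n) * (2 * pi) / N"
proof (rule diameter_le)
  fix x y assume x: "x \<in> slice_cell j N g" and y: "y \<in> slice_cell j N g"
  have "norm (x $ i - y $ i) \<le> 2 * pi / N" for i
  proof (cases "i = j")
    case False
    have "\<exists>t::real. real (g i) \<le> N * t \<and> N * t \<le> real (g i) + 1 \<and> z $ i = cis (2 * pi * t)"
      if "z \<in> slice_cell j N g" for z
      using that False by (simp add: slice_cell_def)
    from this[OF x] this[OF y] obtain s t :: real
      where s: "real (g i) \<le> N * s" "N * s \<le> real (g i) + 1" "x $ i = cis (2 * pi * s)"
        and t: "real (g i) \<le> N * t" "N * t \<le> real (g i) + 1" "y $ i = cis (2 * pi * t)"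
      by blast
    have "norm (x $ i - y $ i) \<le> \<bar>2 * pi * s - 2 * pi * t\<bar>"
      unfolding s(3) t(3) by (rule norm_cis_diff_le)
    also have "\<dots> = 2 * pi * \<bar>s - t\<bar>"
      by (simp add: abs_mult flip: right_diff_distrib)
    also have "\<bar>s - t\<bar> \<le> 1 / N"
    proof -
      have "N * \<bar>s - t\<bar> = \<bar>N * s - N * t\<bar>"
        by (simp add: abs_mult flip: right_diff_distrib)
      also have "\<dots> \<le> 1" using s t by linarith
      finally show ?thesis using assms by (simp add: field_simps)
    qed
    finally show ?thesis by simp
  qed (use x y in \<open>simp add: slice_cell_def\<close>)
  then have "(\<Sum>i\<in>UNIV. norm ((x - y) $ i)) \<le> (\<Sum>i\<in>(UNIV::'n set). 2 * pi / N)"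
    by (intro sum_mono) simp
  moreover have "norm (x - y) \<le> (\<Sum>i\<in>UNIV. norm ((x - y) $ i))"
    unfolding norm_vec_def by (rule L2_set_le_sum) simp
  ultimately show "norm (x - y) \<le> CARD('n) * (2 * pi) / N" by simp
qed simp

text \<open>The bound is the number of grid cells times the s-th power of a common diameter bound.
  The factor CARD('n) in the latter comes from estimating the Euclidean norm by the sum over
  coordinates.\<close>

lemma hausdorff_premeasure_slice_le:
  fixes j :: "'n::finite"
  assumes N: "N > 0" "CARD('n) * (2 * pi) / N \<le> \<delta>" and s: "s > 0"
  shows "hausdorff_premeasure s \<delta> (torus_slice j)
    \<le> ennreal (real N ^ (CARD('n) - 1) * (CARD('n) * (2 * pi) / N) powr s)"
proof -
  \<comment> \<open>The index at j is frozen at 0 so that each cell is counted once, which gives N ^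
    (n-1) cells.\<close>
  define G where "G = PiE UNIV (\<lambda>i. if i = j then {0::nat} else {..<N})"
  have "finite G" unfolding G_def by (intro finite_PiE) auto
  have "card G = (\<Prod>i\<in>UNIV. card (if i = j then {0::nat} else {..<N}))"
    unfolding G_def by (rule card_PiE) simp
  also have "\<dots> = (\<Prod>i\<in>insert j (UNIV - {j}). if i = j then 1 else N)"
    by (intro prod.cong) auto
  also have "\<dots> = N ^ (CARD('n) - 1)"
    by (subst prod.insert) (auto simp: card_Diff_singleton)
  finally have card: "card G = N ^ (CARD('n) - 1)" .
  obtain h where h: "bij_betw h {0..<card G} G"
    using ex_bij_betw_nat_finite[OF \<open>finite G\<close>] by auto
  \<comment> \<open>The finite family is padded by empty sets of gauge 0, which turns the series
    into a finite sum.\<close>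
  define U where "U i = (if i < card G then slice_cell j N (h i) else {})" for i
  have diam: "diameter (U i) \<le> CARD('n) * (2 * pi) / N" for i
    using diameter_slice_cell[OF N(1)] by (auto simp: U_def)
  have bdd: "bounded (U i)" for i
    by (rule bounded_subset[OF compact_imp_bounded[OF compact_torus]]) (auto simp: U_def slice_cell_def)
  have cover: "torus_slice j \<subseteq> (\<Union>i. U i)"
  proof
    fix \<xi> assume \<xi>: "\<xi> \<in> torus_slice j"
    have "\<exists>t. 0 \<le> t \<and> t < 1 \<and> \<xi> $ i = cis (2 * pi * t)" for i
      using \<xi> unimodular_cis[of "\<xi> $ i"] by (auto simp: torus_slice_def torus_def)
    then obtain t where t: "\<And>i. 0 \<le> t i" "\<And>i. t i < 1" "\<And>i. \<xi> $ i = cis (2 * pi * t i)"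
      by metis
    define g where "g i = (if i = j then 0 else nat \<lfloor>N * t i\<rfloor>)" for i
    have g: "real (g i) \<le> N * t i \<and> N * t i \<le> real (g i) + 1" if "i \<noteq> j" for i
    proof -
      have "0 \<le> \<lfloor>N * t i\<rfloor>" using t(1)[of i] by simp
      then have "real (nat \<lfloor>N * t i\<rfloor>) = of_int \<lfloor>N * t i\<rfloor>" by simp
      then show ?thesis
        using that floor_correct[of "N * t i"] unfolding g_def by simp
    qed
    have "g i < N" if "i \<noteq> j" for i
    proof -
      have "real (g i) \<le> N * t i" using g[OF that] by simp
      also have "\<dots> < real N" using t(2)[of i] N(1) by simp
      finally show ?thesis by simp
    qed
    then have "g \<in> G" by (auto simp: G_def g_def)
    then have "g \<in> h ` {0..<card G}"
      using bij_betw_imp_surj_on[OF h] by simp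
    then obtain i where i: "i < card G" "h i = g" by auto
    have "\<xi> \<in> slice_cell j N g"
      using \<xi> g t(3) by (auto simp: slice_cell_def torus_slice_def)
    then show "\<xi> \<in> (\<Union>i. U i)" using i by (auto simp: U_def intro!: exI[of _ i])
  qed
  have "hausdorff_premeasure s \<delta> (torus_slice j) \<le> (\<Sum>i. hausdorff_gauge s (U i))"
    unfolding hausdorff_premeasure_def
    using cover bdd diam N(2) by (intro INF_lower) (auto intro: order_trans)
  also have "\<dots> = (\<Sum>i<card G. hausdorff_gauge s (U i))"
    by (intro suminf_finite) (auto simp: U_def hausdorff_gauge_def)
  also have "\<dots> \<le> (\<Sum>i<card G. ennreal ((CARD('n) * (2 * pi) / N) powr s))"
    using s diam diameter_ge_0[OF bdd]
    by (intro sum_mono) (auto simp: hausdorff_gauge_def intro!: ennreal_leI powr_mono2)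
  also have "\<dots> = ennreal (real N ^ (CARD('n) - 1) * (CARD('n) * (2 * pi) / N) powr s)"
    by (simp add: card ennreal_mult ennreal_of_nat_eq_real_of_nat)
  finally show ?thesis .
qed

text \<open>At mesh 1/N the cost is a constant times N to the power n-1-s, which tends to 0; every
  scale \<delta> admits all sufficiently fine meshes.\<close>

lemma hausdorff_measure_slice:
  fixes j :: "'n::finite"
  assumes s: "s > real (CARD('n) - 1)"
  shows "hausdorff_measure s (torus_slice j) = 0"
proof -
  define d where "d = CARD('n) - 1"
  let ?C = "CARD('n) * (2 * pi)"
  have "s > 0"
    using of_nat_0_le_iff s by (rule le_less_trans)
  have "hausdorff_premeasure s \<delta> (torus_slice j) \<le> 0" if "\<delta> > 0" for \<delta>
  proof (rule LIMSEQ_le_const)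
    have "(\<lambda>N. real N powr (real d - s)) \<longlonglongrightarrow> 0"
      using s by (intro tendsto_neg_powr filterlim_real_sequentially) (simp add: d_def)
    then have "(\<lambda>N. ennreal (?C powr s * real N powr (real d - s))) \<longlonglongrightarrow> ennreal (?C powr s * 0)"
      by (intro tendsto_ennrealI tendsto_mult tendsto_const)
    then show "(\<lambda>N. ennreal (?C powr s * real N powr (real d - s))) \<longlonglongrightarrow> 0" by simp
    obtain N0 where N0: "?C / \<delta> < real N0"
      using reals_Archimedean2 by blast
    show "\<exists>N0. \<forall>N\<ge>N0. hausdorff_premeasure s \<delta> (torus_slice j) \<le> ennreal (?C powr s * real N powr (real d - s))"
    proof (intro exI allI impI)
      fix N assume "N \<ge> max 1 N0"
      then have N: "N > 0" "?C / \<delta> \<le> real N" using N0 by auto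
      then have "?C / N \<le> \<delta>"
        using that by (simp add: field_simps)
      then have "hausdorff_premeasure s \<delta> (torus_slice j) \<le> ennreal (real N ^ d * (?C / N) powr s)"
        unfolding d_def using N(1) \<open>s > 0\<close> by (intro hausdorff_premeasure_slice_le)
      also have "real N ^ d * (?C / N) powr s = ?C powr s * real N powr (real d - s)"
        using N(1) by (simp add: powr_divide powr_diff powr_realpow)
      finally show "hausdorff_premeasure s \<delta> (torus_slice j) \<le> ennreal (?C powr s * real N powr (real d - s))" .
    qed
  qed
  then show ?thesis
    unfolding hausdorff_measure_def by (intro antisym SUP_least) auto
qed

text \<open>Nullity is available for exponents strictly above n-1, so the bound is reached through
  an arbitrary positive e.\<close>

lemma hausdorff_dim_slice_le:
  "hausdorff_dim (torus_slice (j :: 'n::finite)) \<le> ereal (real (CARD('n) - 1))"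
proof (rule ereal_le_epsilon2)
  fix e :: real assume "e > 0"
  then have "hausdorff_dim (torus_slice j) \<le> ereal (real (CARD('n) - 1) + e)"
    unfolding hausdorff_dim_def by (intro INF_lower) (auto intro!: hausdorff_measure_slice)
  then show "hausdorff_dim (torus_slice j) \<le> ereal (real (CARD('n) - 1)) + ereal e" by simp
qed

lemma total_variation_ge_norm:
  assumes "\<mu> {} = 0" "E \<in> sets M"
  shows "ennreal (norm (\<mu> E)) \<le> total_variation M \<mu> E"
proof -
  let ?A = "binaryset E {}"
  have "(\<lambda>i. ennreal (norm (\<mu> (?A i)))) sums (ennreal (norm (\<mu> E)) + ennreal (norm (\<mu> {})))"
    using assms(1) by (intro binaryset_sums) auto
  then have "ennreal (norm (\<mu> E)) = (\<Sum>i. ennreal (norm (\<mu> (?A i))))"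
    using assms(1) by (simp add: sums_iff)
  also have "\<dots> \<le> total_variation M \<mu> E"
    unfolding total_variation_def
  proof (rule SUP_upper, clarify, intro conjI)
    show "range ?A \<subseteq> sets M" using assms(2) by (auto simp: range_binaryset_eq)
    show "disjoint_family ?A" by (intro disjoint_family_binaryset) auto
    show "(\<Union>i. ?A i) = E" by (auto simp: UN_binaryset_eq)
  qed
  finally show ?thesis .
qed

lemma dim_dirac_lebesgue_le:
  "measure_hausdorff_dim torus_borel (\<lambda>E. complex_of_real (measure (dirac_lebesgue (j :: 'n::finite)) E))
    \<le> ereal (real (CARD('n) - 1))"
proof -
  have "1 \<le> total_variation torus_borel (\<lambda>E. complex_of_real (measure (dirac_lebesgue j) E)) (torus_slice j)"
    using total_variation_ge_norm[of "\<lambda>E. complex_of_real (measure (dirac_lebesgue j) E)" "torus_slice j" torus_borel]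
    by (simp add: torus_slice_sets measure_dirac_lebesgue_slice)
  then have "0 < total_variation torus_borel (\<lambda>E. complex_of_real (measure (dirac_lebesgue j) E)) (torus_slice j)"
    by (rule less_le_trans[OF zero_less_one])
  then show ?thesis
    unfolding measure_hausdorff_dim_def
    by (intro INF_lower2[of "torus_slice j"] hausdorff_dim_slice_le) (simp add: torus_slice_sets)
qed

text \<open>The index type has no distinguished first element, so sharpness is established with the
  Dirac factor in an arbitrary coordinate j.\<close>

theorem mainTheorem4:
  assumes "CARD('n::finite) \<ge> 2"
  shows "(\<forall>\<mu> :: (complex ^ 'n) set \<Rightarrow> complex. pluriharmonic \<mu> \<longrightarrow>
            measure_hausdorff_dim torus_borel \<mu> \<ge> ereal (real CARD('n) - 1)) \<and>
         (\<forall>(j :: 'n) \<mu>. \<mu> = (\<lambda>E. complex_of_real (measure (dirac_lebesgue j) E)) \<longrightarrow>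
            pluriharmonic \<mu> \<and>
            measure_hausdorff_dim torus_borel \<mu> = ereal (real CARD('n) - 1))"
proof (intro conjI allI impI)
  show "ereal (real CARD('n) - 1) \<le> measure_hausdorff_dim torus_borel \<mu>"
    if "pluriharmonic \<mu>" for \<mu> :: "(complex ^ 'n) set \<Rightarrow> complex"
    using assms that by (rule pluriharmonic_dim_ge)
  fix j :: 'n and \<mu>
  assume \<mu>: "\<mu> = (\<lambda>E. complex_of_real (measure (dirac_lebesgue j) E))"
  show ph: "pluriharmonic \<mu>"
    unfolding \<mu> by (rule pluriharmonic_dirac_lebesgue)
  have "measure_hausdorff_dim torus_borel \<mu> \<le> ereal (real CARD('n) - 1)"
    using dim_dirac_lebesgue_le[of j] assms by (simp add: \<mu> of_nat_diff)
  then show "measure_hausdorff_dim torus_borel \<mu> = ereal (real CARD('n) - 1)"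
    using pluriharmonic_dim_ge[OF assms ph] by (rule antisym)
qed

end
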